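(* Let $k$ be a field of characteristic $0$ and let $\mathcal{P}$ be the shuffle operad over $k$ associated with the symmetric operad governing commutative Gelfand--Dorfman algebras, presented by two binary generators $x$ (the commutative product) and $z$ (the Lie bracket) and the quadratic relations listed in the context. Then, with respect to a monomial order on the free shuffle operad generated by $x,z$ for which the left-hand side of each rule below is the leading monomial, a Gröbner basis of the ideal of relations of $\mathcal{P}$ up to degree (arity) $4$ is given by the following rewriting rules (each rule $u\to v$ standing for the element $u-v$). In arity $3$: $$x(x(1\;3)\;2)\to x(1\;x(2\;3)),\qquad x(x(1\;2)\;3)\to x(1\;x(2\;3)),$$ $$z(x(1\;2)\;3)\to 2\,x(z(1\;3)\;2)-z(1\;x(2\;3)),$$ $$x(z(1\;2)\;3)\to x(z(1\;3)\;2)-x(1\;z(2\;3)),$$ $$z(z(1\;2)\;3)\to z(z(1\;3)\;2)+z(1\;z(2\;3)),$$ $$z(x(1\;3)\;2)\to 2\,x(z(1\;3)\;2)-z(1\;x(2\;3))-2\,x(1\;z(2\;3)).$$ In arity $4$: $$x(z(1\;4)\;z(2\;3))\to x(z(1\;3)\;z(2\;4))-x(z(1\;z(3\;4))\;2)+x(1\;z(2\;z(3\;4))),$$ $$x(z(1\;3)\;x(2\;4))\to z(1\;x(2\;x(3\;4)))+3\,x(1\;x(z(2\;4)\;3))-2\,x(1\;z(2\;x(3\;4)))-2\,x(1\;x(2\;z(3\;4))),$$ $$x(z(1\;4)\;x(2\;3))\to z(1\;x(2\;x(3\;4)))+3\,x(1\;x(z(2\;4)\;3))-2\,x(1\;z(2\;x(3\;4)))-x(1\;x(2\;z(3\;4))),$$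 $$x(z(1\;x(3\;4))\;2)\to z(1\;x(2\;x(3\;4)))+2\,x(1\;x(z(2\;4)\;3))-x(1\;z(2\;x(3\;4)))-x(1\;x(2\;z(3\;4))),$$ $$z(z(1\;4)\;x(2\;3))\to z(z(1\;x(3\;4))\;2)-2\,x(z(1\;3)\;z(2\;4))+z(1\;x(z(2\;4)\;3))+z(1\;z(2\;x(3\;4)))+2\,x(1\;z(z(2\;4)\;3)),$$ $$z(z(1\;3)\;x(2\;4))\to z(z(1\;x(3\;4))\;2)-2\,x(z(1\;3)\;z(2\;4))+2\,x(z(1\;z(3\;4))\;2)+z(1\;x(z(2\;4)\;3))+z(1\;z(2\;x(3\;4)))-z(1\;x(2\;z(3\;4)))+2\,x(1\;z(z(2\;4)\;3)).$$
   Context: A commutative Gelfand--Dorfman algebra is a vector space with a commutative associative product (written by juxtaposition) and a Lie bracket $[\cdot,\cdot]$ satisfying $[x_1,x_2x_3]-[x_3,x_2x_1]+[x_2,x_1]x_3-[x_2,x_3]x_1-[x_1,x_3]x_2=0$. (Equivalently: a Gelfand--Dorfman algebra whose Novikov product is commutative.) Shuffle operads: a shuffle operad is a monoid in the category of nonsymmetric collections of vector spaces with respect to the shuffle composition product $$\mathcal{V}\circ_{\mathrm{sh}}\mathcal{W}(n)=\bigoplus_{r\ge1}\mathcal V(r)\otimes\bigoplus_{\pi}\mathcal W(|I^{(1)}|)\otimes\cdots\otimes\mathcal W(|I^{(r)}|),$$ where $\pi$ ranges over set partitions $\{1,\dots,n\}=\bigsqcup_{j=1}^r I^{(j)}$ into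 nonempty parts with $\min(I^{(1)})<\dots<\min(I^{(r)})$. The forgetful functor from symmetric operads to shuffle operads sends an operad to a shuffle operad with the same components. Notation: $x(1\;2)$ denotes the product $x_1x_2$ and $z(1\;2)$ the bracket $[x_1,x_2]$. Monomials such as $z(x(1\;3)\;2)$ denote shuffle tree monomials in the free shuffle operad on the binary generators $x,z$ (planar binary trees with vertices labelled by $x$ or $z$ and leaves labelled bijectively by $1,\dots,n$, such that at each vertex the minimal leaf label of the left subtree is smaller than that of the right subtree); $z(x(1\;3)\;2)$ corresponds to $[x_1x_3,x_2]$. "Degree" means arity $n$ (number of leaves). Defining relations of $\mathcal P$ (each set equal to $0$): $$x(x(1\;2)\;3)-x(1\;x(2\;3)),\qquad x(x(1\;3)\;2)-x(1\;x(2\;3)),$$ $$z(z(1\;2)\;3)-z(1\;z(2\;3))-z(z(1\;3)\;2),$$ $$z(1\;x(2\;3))+z(x(1\;2)\;3)-x(z(1\;2)\;3)-x(1\;z(2\;3))-x(z(1\;3)\;2),$$ $$-z(x(1\;3)\;2)+z(x(1\;2)\;3)+x(z(1\;2)\;3)-x(z(1\;3)\;2)-x(1\;z(2\;3)),$$ $$-x(z(1\;2)\;3)+z(1\;x(2\;3))+z(x(1\;3)\;2)-x(z(1\;3)\;2)+x(1\;z(2\;3)).$$ Gröbner basis up to degree $4$: given a monomial order (a total order on shuffle tree monomials of each arity compatible with shuffle compositions), a set $G$ of elements of the ideal of relations $I$ is a Gröbner basis up to degree $4$ if the leading monomial of every nonzero element of $I$ of arity at most $4$ is divisible (as a shuffle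 tree monomial) by the leading monomial of some element of $G$. *)

theory Defs
  imports "HOL-Library.Poly_Mapping" "HOL-Library.FuncSet" "HOL-Library.Disjoint_Sets"
begin

section \<open>Shuffle tree monomials\<close>

datatype gen = Prod | Bracket

datatype tree = L nat | Node gen tree tree

abbreviation X :: "tree \<Rightarrow> tree \<Rightarrow> tree" where
  "X \<equiv> Node Prod"

abbreviation Z :: "tree \<Rightarrow> tree \<Rightarrow> tree" where
  "Z \<equiv> Node Bracket"

fun leaves :: "tree \<Rightarrow> nat set" where
  "leaves (L i) = {i}"
| "leaves (Node g s t) = leaves s \<union> leaves t"

fun subst :: "(nat \<Rightarrow> tree) \<Rightarrow> tree \<Rightarrow> tree" where
  "subst \<sigma> (L i) = \<sigma> i"
| "subst \<sigma> (Node g s t) = Node g (subst \<sigma> s) (subst \<sigma> t)"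

fun subtrees :: "tree \<Rightarrow> tree set" where
  "subtrees (L i) = {L i}"
| "subtrees (Node g s t) = insert (Node g s t) (subtrees s \<union> subtrees t)"

fun shuffle_tree :: "tree \<Rightarrow> bool" where
  "shuffle_tree (L i) \<longleftrightarrow> True"
| "shuffle_tree (Node g s t) \<longleftrightarrow> shuffle_tree s \<and> shuffle_tree t \<and>
     leaves s \<inter> leaves t = {} \<and> Min (leaves s) < Min (leaves t)"

definition monomials :: "nat \<Rightarrow> tree set" where
  "monomials n = {t. shuffle_tree t \<and> leaves t = {1..n}}"


section \<open>The free shuffle operad\<close>

definition shuffle_partition :: "nat \<Rightarrow> nat \<Rightarrow> (nat \<Rightarrow> nat set) \<Rightarrow> bool" where
  "shuffle_partition r n I \<longleftrightarrow>
     (\<forall>i\<in>{1..r}. I i \<noteq> {}) \<and> disjoint_family_on I {1..r} \<and> (\<Union>i\<in>{1..r}. I i) = {1..n} \<and>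
     strict_mono_on {1..r} (\<lambda>i. Min (I i))"

text \<open>Leaf \<open>i\<close> of \<open>t\<close> is replaced by \<open>m i\<close>, whose labels \<open>{1..card (I i)}\<close> are first transported
  to \<open>I i\<close> along the increasing bijection.\<close>

definition graft :: "tree \<Rightarrow> (nat \<Rightarrow> nat set) \<Rightarrow> (nat \<Rightarrow> tree) \<Rightarrow> tree" where
  "graft t I m = subst (\<lambda>i. subst (\<lambda>j. L (sorted_list_of_set (I i) ! (j - 1))) (m i)) t"

abbreviation lterm :: "'k::zero \<Rightarrow> tree \<Rightarrow> tree \<Rightarrow>\<^sub>0 'k" (infixr "\<odot>" 75) where
  "c \<odot> t \<equiv> Poly_Mapping.single t c"

definition scale :: "'k::field \<Rightarrow> (tree \<Rightarrow>\<^sub>0 'k) \<Rightarrow> (tree \<Rightarrow>\<^sub>0 'k)" where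
  "scale c f = Poly_Mapping.map ((*) c) f"

definition free_operad :: "nat \<Rightarrow> (tree \<Rightarrow>\<^sub>0 'k::field) set" where
  "free_operad n = {f. Poly_Mapping.keys f \<subseteq> monomials n}"

text \<open>The structure map of the free shuffle operad for the partition \<open>I\<close> into \<open>r\<close> parts: the
  multilinear extension of \<open>graft\<close>.\<close>

definition compose ::
    "nat \<Rightarrow> (nat \<Rightarrow> nat set) \<Rightarrow> (tree \<Rightarrow>\<^sub>0 'k::field) \<Rightarrow> (nat \<Rightarrow> tree \<Rightarrow>\<^sub>0 'k) \<Rightarrow> (tree \<Rightarrow>\<^sub>0 'k)" where
  "compose r I f b =
     (\<Sum>t\<in>Poly_Mapping.keys f. \<Sum>m\<in>(\<Pi>\<^sub>E i\<in>{1..r}. Poly_Mapping.keys (b i)).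
        (Poly_Mapping.lookup f t * (\<Prod>i\<in>{1..r}. Poly_Mapping.lookup (b i) (m i))) \<odot> graft t I m)"

text \<open>\<open>ideal R n\<close> is the arity \<open>n\<close> component of the operadic ideal generated by \<open>R\<close>.\<close>

inductive in_ideal :: "(tree \<Rightarrow>\<^sub>0 'k::field) set \<Rightarrow> nat \<Rightarrow> (tree \<Rightarrow>\<^sub>0 'k) \<Rightarrow> bool"
  for R :: "(tree \<Rightarrow>\<^sub>0 'k) set" where
  generator: "f \<in> R \<Longrightarrow> f \<in> free_operad n \<Longrightarrow> in_ideal R n f"
| zero: "in_ideal R n 0"
| add: "in_ideal R n f \<Longrightarrow> in_ideal R n g \<Longrightarrow> in_ideal R n (f + g)"
| scale: "in_ideal R n f \<Longrightarrow> in_ideal R n (scale c f)"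
| compose_outer: "in_ideal R r f \<Longrightarrow> shuffle_partition r n I \<Longrightarrow>
    (\<And>i. i \<in> {1..r} \<Longrightarrow> b i \<in> free_operad (card (I i))) \<Longrightarrow> in_ideal R n (compose r I f b)"
| compose_inner: "f \<in> free_operad r \<Longrightarrow> shuffle_partition r n I \<Longrightarrow>
    (\<And>i. i \<in> {1..r} \<Longrightarrow> b i \<in> free_operad (card (I i))) \<Longrightarrow>
    j \<in> {1..r} \<Longrightarrow> in_ideal R (card (I j)) (b j) \<Longrightarrow> in_ideal R n (compose r I f b)"

definition ideal :: "(tree \<Rightarrow>\<^sub>0 'k::field) set \<Rightarrow> nat \<Rightarrow> (tree \<Rightarrow>\<^sub>0 'k) set" where
  "ideal R n = {f. in_ideal R n f}"


section \<open>Monomial orders and Groebner bases\<close>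

text \<open>Monomials are only compared within a fixed arity; \<open>lt\<close> is the strict order.\<close>

definition monomial_order :: "(tree \<Rightarrow> tree \<Rightarrow> bool) \<Rightarrow> bool" where
  "monomial_order lt \<longleftrightarrow>
     (\<forall>n. irreflp_on (monomials n) lt \<and> transp_on (monomials n) lt \<and>
          totalp_on (monomials n) lt) \<and>
     (\<forall>r n I s t m. shuffle_partition r n I \<longrightarrow> s \<in> monomials r \<longrightarrow> t \<in> monomials r \<longrightarrow>
        (\<forall>i\<in>{1..r}. m i \<in> monomials (card (I i))) \<longrightarrow>
        lt s t \<longrightarrow> lt (graft s I m) (graft t I m)) \<and>
     (\<forall>r n I t m j u. shuffle_partition r n I \<longrightarrow> t \<in> monomials r \<longrightarrow>
        (\<forall>i\<in>{1..r}. m i \<in> monomials (card (I i))) \<longrightarrow>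
        j \<in> {1..r} \<longrightarrow> u \<in> monomials (card (I j)) \<longrightarrow>
        lt (m j) u \<longrightarrow> lt (graft t I m) (graft t I (m(j := u))))"

definition is_leading :: "(tree \<Rightarrow> tree \<Rightarrow> bool) \<Rightarrow> (tree \<Rightarrow>\<^sub>0 'k::zero) \<Rightarrow> tree \<Rightarrow> bool" where
  "is_leading lt f t \<longleftrightarrow>
     t \<in> Poly_Mapping.keys f \<and> (\<forall>s\<in>Poly_Mapping.keys f. s \<noteq> t \<longrightarrow> lt s t)"

text \<open>\<open>s\<close> divides \<open>t\<close> if \<open>s\<close> occurs in \<open>t\<close> as a connected piece: some subtree of \<open>t\<close> arises from \<open>s\<close>
  by grafting trees \<open>\<sigma> i\<close> onto its leaves, such that labelling each leaf \<open>i\<close> of the piece by the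
  minimum of the labels above it, and standardising, gives back the labelling of \<open>s\<close>.\<close>

definition divides :: "tree \<Rightarrow> tree \<Rightarrow> bool" where
  "divides s t \<longleftrightarrow>
     (\<exists>\<sigma>. subst \<sigma> s \<in> subtrees t \<and> strict_mono_on (leaves s) (\<lambda>i. Min (leaves (\<sigma> i))))"

definition groebner_basis_upto ::
    "nat \<Rightarrow> (tree \<Rightarrow> tree \<Rightarrow> bool) \<Rightarrow> (nat \<Rightarrow> (tree \<Rightarrow>\<^sub>0 'k::field) set) \<Rightarrow> (tree \<Rightarrow>\<^sub>0 'k) set \<Rightarrow> bool" where
  "groebner_basis_upto d lt J G \<longleftrightarrow>
     G \<subseteq> (\<Union>n. J n) \<and>
     (\<forall>n\<le>d. \<forall>f\<in>J n. f \<noteq> 0 \<longrightarrow>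
        (\<exists>t. is_leading lt f t \<and> (\<exists>g\<in>G. \<exists>s. is_leading lt g s \<and> divides s t)))"


section \<open>Commutative Gelfand--Dorfman algebras\<close>

text \<open>Writing \<open>L i\<close> for the argument \<open>x_i\<close>, \<open>X\<close> for the commutative product and \<open>Z\<close> for the Lie bracket,
  these relations span the consequences in arity 3, over all permutations of the arguments, of
  commutativity and associativity of the product, the Lie axioms, and the identity
  \<open>[x_1, x_2 x_3] - [x_3, x_2 x_1] + [x_2, x_1] x_3 - [x_2, x_3] x_1 - [x_1, x_3] x_2 = 0\<close>,
  rewritten in shuffle tree monomials.\<close>

definition comGD_relations :: "(tree \<Rightarrow>\<^sub>0 'k::field_char_0) set" where
  "comGD_relations = {
   1 \<odot> X (X (L 1) (L 2)) (L 3) - 1 \<odot> X (L 1) (X (L 2) (L 3)),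
   1 \<odot> X (X (L 1) (L 3)) (L 2) - 1 \<odot> X (L 1) (X (L 2) (L 3)),
   1 \<odot> Z (Z (L 1) (L 2)) (L 3) - 1 \<odot> Z (L 1) (Z (L 2) (L 3)) - 1 \<odot> Z (Z (L 1) (L 3)) (L 2),
   1 \<odot> Z (L 1) (X (L 2) (L 3)) + 1 \<odot> Z (X (L 1) (L 2)) (L 3) - 1 \<odot> X (Z (L 1) (L 2)) (L 3)
     - 1 \<odot> X (L 1) (Z (L 2) (L 3)) - 1 \<odot> X (Z (L 1) (L 3)) (L 2),
   - 1 \<odot> Z (X (L 1) (L 3)) (L 2) + 1 \<odot> Z (X (L 1) (L 2)) (L 3) + 1 \<odot> X (Z (L 1) (L 2)) (L 3)
     - 1 \<odot> X (Z (L 1) (L 3)) (L 2) - 1 \<odot> X (L 1) (Z (L 2) (L 3)),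
   - 1 \<odot> X (Z (L 1) (L 2)) (L 3) + 1 \<odot> Z (L 1) (X (L 2) (L 3)) + 1 \<odot> Z (X (L 1) (L 3)) (L 2)
     - 1 \<odot> X (Z (L 1) (L 3)) (L 2) + 1 \<odot> X (L 1) (Z (L 2) (L 3))}"

text \<open>A rule \<open>(u, v)\<close> stands for the rewriting rule \<open>u \<rightarrow> v\<close>.\<close>

definition comGD_rules :: "(tree \<times> (tree \<Rightarrow>\<^sub>0 'k::field_char_0)) set" where
  "comGD_rules = {
   (X (X (L 1) (L 3)) (L 2),
      1 \<odot> X (L 1) (X (L 2) (L 3))),
   (X (X (L 1) (L 2)) (L 3),
      1 \<odot> X (L 1) (X (L 2) (L 3))),
   (Z (X (L 1) (L 2)) (L 3),
      2 \<odot> X (Z (L 1) (L 3)) (L 2) - 1 \<odot> Z (L 1) (X (L 2) (L 3))),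
   (X (Z (L 1) (L 2)) (L 3),
      1 \<odot> X (Z (L 1) (L 3)) (L 2) - 1 \<odot> X (L 1) (Z (L 2) (L 3))),
   (Z (Z (L 1) (L 2)) (L 3),
      1 \<odot> Z (Z (L 1) (L 3)) (L 2) + 1 \<odot> Z (L 1) (Z (L 2) (L 3))),
   (Z (X (L 1) (L 3)) (L 2),
      2 \<odot> X (Z (L 1) (L 3)) (L 2) - 1 \<odot> Z (L 1) (X (L 2) (L 3)) - 2 \<odot> X (L 1) (Z (L 2) (L 3))),
   (X (Z (L 1) (L 4)) (Z (L 2) (L 3)),
      1 \<odot> X (Z (L 1) (L 3)) (Z (L 2) (L 4)) - 1 \<odot> X (Z (L 1) (Z (L 3) (L 4))) (L 2)
        + 1 \<odot> X (L 1) (Z (L 2) (Z (L 3) (L 4)))),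
   (X (Z (L 1) (L 3)) (X (L 2) (L 4)),
      1 \<odot> Z (L 1) (X (L 2) (X (L 3) (L 4))) + 3 \<odot> X (L 1) (X (Z (L 2) (L 4)) (L 3))
        - 2 \<odot> X (L 1) (Z (L 2) (X (L 3) (L 4))) - 2 \<odot> X (L 1) (X (L 2) (Z (L 3) (L 4)))),
   (X (Z (L 1) (L 4)) (X (L 2) (L 3)),
      1 \<odot> Z (L 1) (X (L 2) (X (L 3) (L 4))) + 3 \<odot> X (L 1) (X (Z (L 2) (L 4)) (L 3))
        - 2 \<odot> X (L 1) (Z (L 2) (X (L 3) (L 4))) - 1 \<odot> X (L 1) (X (L 2) (Z (L 3) (L 4)))),
   (X (Z (L 1) (X (L 3) (L 4))) (L 2),
      1 \<odot> Z (L 1) (X (L 2) (X (L 3) (L 4))) + 2 \<odot> X (L 1) (X (Z (L 2) (L 4)) (L 3))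
        - 1 \<odot> X (L 1) (Z (L 2) (X (L 3) (L 4))) - 1 \<odot> X (L 1) (X (L 2) (Z (L 3) (L 4)))),
   (Z (Z (L 1) (L 4)) (X (L 2) (L 3)),
      1 \<odot> Z (Z (L 1) (X (L 3) (L 4))) (L 2) - 2 \<odot> X (Z (L 1) (L 3)) (Z (L 2) (L 4))
        + 1 \<odot> Z (L 1) (X (Z (L 2) (L 4)) (L 3)) + 1 \<odot> Z (L 1) (Z (L 2) (X (L 3) (L 4)))
        + 2 \<odot> X (L 1) (Z (Z (L 2) (L 4)) (L 3))),
   (Z (Z (L 1) (L 3)) (X (L 2) (L 4)),
      1 \<odot> Z (Z (L 1) (X (L 3) (L 4))) (L 2) - 2 \<odot> X (Z (L 1) (L 3)) (Z (L 2) (L 4))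
        + 2 \<odot> X (Z (L 1) (Z (L 3) (L 4))) (L 2) + 1 \<odot> Z (L 1) (X (Z (L 2) (L 4)) (L 3))
        + 1 \<odot> Z (L 1) (Z (L 2) (X (L 3) (L 4))) - 1 \<odot> Z (L 1) (X (L 2) (Z (L 3) (L 4)))
        + 2 \<odot> X (L 1) (Z (Z (L 2) (L 4)) (L 3)))}"

definition rule_elem :: "tree \<times> (tree \<Rightarrow>\<^sub>0 'k::field_char_0) \<Rightarrow> (tree \<Rightarrow>\<^sub>0 'k)" where
  "rule_elem = (\<lambda>(u, v). 1 \<odot> u - v)"

definition rules_oriented ::
    "(tree \<Rightarrow> tree \<Rightarrow> bool) \<Rightarrow> (tree \<times> (tree \<Rightarrow>\<^sub>0 'k::field_char_0)) set \<Rightarrow> bool" where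
  "rules_oriented lt S \<longleftrightarrow> (\<forall>(u, v)\<in>S. is_leading lt (rule_elem (u, v)) u)"

end

theory Submission
  imports Defs "HOL-Computational_Algebra.Polynomial"
begin

text \<open>\<^bold>\<open>The order.\<close> Reading a shuffle tree from the root to the leaf labelled \<open>l\<close> gives a word in the four
  letters (operation, direction). Compare two trees at the smallest label at which their words
  differ, shorter words being smaller and words of equal length being compared lexicographically,
  with \<open>Bracket\<close> above \<open>Prod\<close> and right above left. A composition multiplies the words by common
  prefixes or suffixes and carries the first difference of two trees to a first difference
  (\<open>path_less_outer\<close>, \<open>path_less_inner\<close>), so the order is compatible with composition. Because the
  letters record directions, the words determine the tree, and the order is total without any
  tie-breaking by permutations.

  \<^bold>\<open>The Groebner basis.\<close> Fix any order orienting the rules, and call a monomial irreducible if no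
  left-hand side divides it. Every reducible monomial is the leading monomial of an element of the
  ideal (\<open>leading_of_divisible\<close>). If an element of the ideal had an irreducible leading monomial,
  one could subtract such elements until all its monomials are irreducible, without touching the
  leading one (\<open>leading_reducible\<close>). So the claim amounts to the linear independence of the
  irreducible monomials modulo the ideal; there are 1, 2, 6, 20 of them in arities 1, 2, 3, 4.

  Independence is seen in a model. A commutative algebra with a derivation \<open>D\<close> is a commutative
  Gelfand--Dorfman algebra for the Wronskian bracket \<open>[a, b] = a D b - b D a\<close>; take \<open>k[t]\<close> with
  \<open>D = t d/dt\<close>. Substituting \<open>x_i = t^(e_i)\<close> turns a tree into a polynomial in the exponents \<open>e_i\<close>
  times the fixed power \<open>t^(e_1 + ... + e_n)\<close>, while elements of the ideal become \<open>0\<close>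
  (\<open>ideal_vanishes\<close>). Up to arity 4 this model is faithful: finitely many choices of the exponents
  give linear equations that force all coefficients of an irreducible combination to vanish.

  \<^bold>\<open>Membership.\<close> That the rules themselves belong to the ideal is linear algebra: the rules of arity 3
  are combinations of the relations, and those of arity 4 are combinations of compositions of rules
  of arity 3 with one further operation.\<close>

text \<open>Labels start at \<open>1\<close>: the literal has to survive simplification, so that facts about \<open>{1..n}\<close> apply.\<close>

declare One_nat_def [simp del]

section \<open>Substitution into shuffle trees\<close>

lemma finite_leaves [simp]: "finite (leaves t)"
  by (induction t) auto

lemma leaves_nonempty [simp]: "leaves t \<noteq> {}"
  by (induction t) auto

lemma subst_cong: "(\<And>i. i \<in> leaves t \<Longrightarrow> \<sigma> i = \<tau> i) \<Longrightarrow> subst \<sigma> t = subst \<tau> t"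
  by (induction t) auto

lemma subst_subst: "subst \<tau> (subst \<sigma> t) = subst (\<lambda>i. subst \<tau> (\<sigma> i)) t"
  by (induction t) auto

lemma subst_L [simp]: "subst L t = t"
  by (induction t) auto

lemma leaves_subst: "leaves (subst \<sigma> t) = (\<Union>i\<in>leaves t. leaves (\<sigma> i))"
  by (induction t) auto

text \<open>The condition on a family of trees under which grafting its members onto the leaves \<open>K\<close> of a
  shuffle tree yields a shuffle tree again. The labels of the family may form any set.\<close>

definition admissible :: "nat set \<Rightarrow> (nat \<Rightarrow> tree) \<Rightarrow> bool" where
  "admissible K \<sigma> \<longleftrightarrow> (\<forall>i\<in>K. shuffle_tree (\<sigma> i)) \<and> disjoint_family_on (\<lambda>i. leaves (\<sigma> i)) K \<and>
     strict_mono_on K (\<lambda>i. Min (leaves (\<sigma> i)))"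

lemma admissible_subset: "admissible K \<sigma> \<Longrightarrow> K' \<subseteq> K \<Longrightarrow> admissible K' \<sigma>"
  unfolding admissible_def by (meson disjoint_family_on_mono monotone_on_subset subsetD)

text \<open>The minimum of a shuffle tree sits at its leftmost leaf. Hence grafting an admissible family keeps
  the minima of sibling subtrees in order, and the two claims have to be proved together.\<close>

lemma shuffle_tree_subst:
  assumes "shuffle_tree t" "admissible (leaves t) \<sigma>"
  shows "shuffle_tree (subst \<sigma> t) \<and> Min (leaves (subst \<sigma> t)) = Min (leaves (\<sigma> (Min (leaves t))))"
  using assms
proof (induction t)
  case (L i)
  then show ?case by (simp add: admissible_def)
next
  case (Node g s t)
  have ad: "admissible (leaves s) \<sigma>" "admissible (leaves t) \<sigma>"
    using Node.prems(2) by (auto elim!: admissible_subset)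
  have IH: "shuffle_tree (subst \<sigma> s)" "Min (leaves (subst \<sigma> s)) = Min (leaves (\<sigma> (Min (leaves s))))"
     "shuffle_tree (subst \<sigma> t)" "Min (leaves (subst \<sigma> t)) = Min (leaves (\<sigma> (Min (leaves t))))"
    using Node.IH Node.prems(1) ad by auto
  have lt: "Min (leaves s) < Min (leaves t)" using Node.prems(1) by simp
  have M: "Min (leaves s) \<in> leaves s" "Min (leaves t) \<in> leaves t" by simp_all
  have mono: "strict_mono_on (leaves s \<union> leaves t) (\<lambda>i. Min (leaves (\<sigma> i)))"
    using Node.prems(2) by (simp add: admissible_def)
  have dis: "disjoint_family_on (\<lambda>i. leaves (\<sigma> i)) (leaves s \<union> leaves t)"
    using Node.prems(2) by (simp add: admissible_def)
  have lt': "Min (leaves (subst \<sigma> s)) < Min (leaves (subst \<sigma> t))"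
    unfolding IH using strict_mono_onD[OF mono _ _ lt] M by blast
  have "leaves (subst \<sigma> s) \<inter> leaves (subst \<sigma> t) = {}"
    unfolding leaves_subst
  proof (intro equals0I, elim IntE UN_E)
    fix l i j assume l: "i \<in> leaves s" "j \<in> leaves t" "l \<in> leaves (\<sigma> i)" "l \<in> leaves (\<sigma> j)"
    then have "i \<noteq> j" using Node.prems(1) by auto
    then show False using l disjoint_family_onD[OF dis, of i j] by auto
  qed
  moreover have "Min (leaves s \<union> leaves t) = Min (leaves s)"
    using lt by (simp add: Min_Un)
  ultimately show ?case using IH lt' by (simp add: Min_Un)
qed

section \<open>Standardisation\<close>

text \<open>The increasing bijection from \<open>S\<close> onto \<open>{1..card S}\<close>, inverse to indexing the sorted list of \<open>S\<close>.\<close>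

definition rank :: "nat set \<Rightarrow> nat \<Rightarrow> nat" where
  "rank S l = card {x\<in>S. x \<le> l}"

lemma strict_mono_on_rank: "finite S \<Longrightarrow> strict_mono_on S (rank S)"
  unfolding rank_def by (intro strict_mono_onI psubset_card_mono psubsetI) (auto dest: order.strict_implies_order, force)

lemma rank_image: "finite S \<Longrightarrow> rank S ` S = {1..card S}"
proof -
  assume fin: "finite S"
  have "rank S ` S \<subseteq> {1..card S}"
    using fin by (auto simp: rank_def One_nat_def Suc_le_eq card_gt_0_iff intro!: card_mono)
  moreover have "card (rank S ` S) = card S"
    by (intro card_image strict_mono_on_imp_inj_on strict_mono_on_rank fin)
  ultimately show ?thesis by (intro card_subset_eq) auto
qed

lemma nth_rank: "finite S \<Longrightarrow> l \<in> S \<Longrightarrow> sorted_list_of_set S ! (rank S l - 1) = l"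
proof -
  assume fin: "finite S" and l: "l \<in> S"
  let ?xs = "sorted_list_of_set S"
  have st: "sorted_wrt (<) ?xs" by simp
  obtain p where p: "p < length ?xs" "?xs ! p = l"
    using l fin by (metis in_set_conv_nth set_sorted_list_of_set)
  have "{x\<in>S. x \<le> l} = (!) ?xs ` {..p}"
  proof (intro equalityI subsetI)
    fix x assume "x \<in> {x\<in>S. x \<le> l}"
    then obtain q where q: "q < length ?xs" "?xs ! q = x" "x \<le> l"
      using fin by (metis (no_types, lifting) in_set_conv_nth mem_Collect_eq set_sorted_list_of_set)
    then have "q \<le> p" using p sorted_wrt_nth_less[OF st, of p q]
      by (metis leD not_le_imp_less)
    then show "x \<in> (!) ?xs ` {..p}" using q by auto
  next
    fix x assume "x \<in> (!) ?xs ` {..p}"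
    then obtain q where q: "q \<le> p" "x = ?xs ! q" by auto
    then have "x \<in> S" using p fin by (metis le_less_trans nth_mem set_sorted_list_of_set)
    moreover have "x \<le> l" using q p sorted_wrt_nth_less[OF st, of q p]
      by (cases "q = p") auto
    ultimately show "x \<in> {x\<in>S. x \<le> l}" by simp
  qed
  moreover have "inj_on ((!) ?xs) {..p}"
    using p by (intro inj_on_nth) auto
  ultimately have "rank S l = Suc p" by (simp add: rank_def card_image)
  then show ?thesis using p by simp
qed

lemma rank_interval [simp]: "l \<in> {1..n} \<Longrightarrow> rank {1..n} l = l"
proof -
  assume "l \<in> {1..n}"
  then have "{x \<in> {1..n}. x \<le> l} = {1..l}" by auto
  then show ?thesis by (simp add: rank_def)
qed

lemma rank_strict_mono_image:
  assumes "finite S" "strict_mono_on S e" "l \<in> S"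
  shows "rank (e ` S) (e l) = rank S l"
proof -
  have "{x \<in> e ` S. x \<le> e l} = e ` {x\<in>S. x \<le> l}"
    using assms by (auto simp: strict_mono_on_less_eq)
  moreover have "inj_on e {x\<in>S. x \<le> l}"
    using strict_mono_on_imp_inj_on[OF assms(2)] by (rule inj_on_subset) auto
  ultimately show ?thesis by (simp add: rank_def card_image)
qed

abbreviation relabel :: "nat set \<Rightarrow> tree \<Rightarrow> tree" where
  "relabel S \<equiv> subst (\<lambda>j. L (sorted_list_of_set S ! (j - 1)))"

definition std :: "tree \<Rightarrow> tree" where
  "std u = subst (\<lambda>l. L (rank (leaves u) l)) u"

lemma relabel_std: "relabel (leaves u) (std u) = u"
proof -
  have "relabel (leaves u) (std u) = subst L u"
    unfolding std_def subst_subst by (rule subst_cong) (simp add: nth_rank)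
  then show ?thesis by simp
qed

lemma admissible_labels: "strict_mono_on S e \<Longrightarrow> admissible S (\<lambda>l. L (e l))"
  unfolding admissible_def disjoint_family_on_def
  using strict_mono_on_imp_inj_on[of S e] by (auto dest: inj_onD)

lemma std_in_monomials: "shuffle_tree u \<Longrightarrow> std u \<in> monomials (card (leaves u))"
  using rank_image[OF finite_leaves, of u]
    shuffle_tree_subst[OF _ admissible_labels[OF strict_mono_on_rank]]
  by (auto simp: monomials_def std_def leaves_subst)

lemma std_eq_self: "t \<in> monomials n \<Longrightarrow> std t = t"
proof -
  assume "t \<in> monomials n"
  then have "std t = subst L t"
    unfolding std_def by (intro subst_cong) (auto simp: monomials_def)
  then show ?thesis by simp
qed

lemma std_relabel: "strict_mono_on (leaves u) e \<Longrightarrow> std (subst (\<lambda>l. L (e l)) u) = std u"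
  unfolding std_def subst_subst
  by (rule subst_cong) (simp add: leaves_subst UNION_singleton_eq_range rank_strict_mono_image)

lemma strict_mono_on_nth_sorted_list:
  "strict_mono_on {1..card S} (\<lambda>j. sorted_list_of_set S ! (j - 1))"
  using sorted_wrt_nth_less[of "(<)" "sorted_list_of_set S"]
  by (intro strict_mono_onI) auto

lemma image_nth_sorted_list: "finite (S :: nat set) \<Longrightarrow> (\<lambda>j. sorted_list_of_set S ! (j - 1)) ` {1..card S} = S"
  using nth_rank[of S] by (auto simp: image_image simp flip: rank_image)

section \<open>Grafting as substitution\<close>

text \<open>Working with families of labelled trees instead of a partition together with standardised trees
  turns \<open>graft\<close> into plain substitution; \<open>graft_inflation\<close> and \<open>inflation_graft\<close> translate between the
  two descriptions.\<close>

definition inflation :: "nat \<Rightarrow> nat \<Rightarrow> (nat \<Rightarrow> tree) \<Rightarrow> bool" where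
  "inflation r n \<sigma> \<longleftrightarrow> admissible {1..r} \<sigma> \<and> (\<Union>i\<in>{1..r}. leaves (\<sigma> i)) = {1..n}"

lemma subst_inflation: "inflation r n \<sigma> \<Longrightarrow> t \<in> monomials r \<Longrightarrow> subst \<sigma> t \<in> monomials n"
  by (auto simp: inflation_def monomials_def shuffle_tree_subst leaves_subst)

lemma relabel_monomial:
  assumes "u \<in> monomials (card S)" "finite S"
  shows "leaves (relabel S u) = S" "shuffle_tree (relabel S u)"
proof -
  have "strict_mono_on (leaves u) (\<lambda>j. sorted_list_of_set S ! (j - 1))"
    using assms(1) by (simp add: monomials_def strict_mono_on_nth_sorted_list)
  then show "shuffle_tree (relabel S u)"
    using assms(1) by (auto simp: monomials_def intro!: shuffle_tree_subst[THEN conjunct1] admissible_labels)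
  show "leaves (relabel S u) = S"
    using assms image_nth_sorted_list[of S] by (auto simp: monomials_def leaves_subst)
qed

lemma graft_inflation:
  assumes "shuffle_partition r n I" "\<forall>i\<in>{1..r}. m i \<in> monomials (card (I i))"
  shows "inflation r n (\<lambda>i. relabel (I i) (m i))" "\<forall>i\<in>{1..r}. leaves (relabel (I i) (m i)) = I i"
proof -
  have fin: "finite (I i)" if "i \<in> {1..r}" for i
    using that assms(1) unfolding shuffle_partition_def by (metis UN_upper finite_atLeastAtMost finite_subset)
  have R: "leaves (relabel (I i) (m i)) = I i" "shuffle_tree (relabel (I i) (m i))" if "i \<in> {1..r}" for i
    using relabel_monomial fin assms(2) that by auto
  show "inflation r n (\<lambda>i. relabel (I i) (m i))"
    using assms(1) R unfolding inflation_def admissible_def shuffle_partition_def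
      disjoint_family_on_def strict_mono_on_def by simp
  show "\<forall>i\<in>{1..r}. leaves (relabel (I i) (m i)) = I i" using R by simp
qed

lemma graft_in_monomials:
  assumes "shuffle_partition r n I" "t \<in> monomials r" "\<forall>i\<in>{1..r}. m i \<in> monomials (card (I i))"
  shows "graft t I m \<in> monomials n"
  unfolding graft_def using graft_inflation(1)[OF assms(1,3)] assms(2) by (rule subst_inflation)

lemma inflation_graft:
  assumes "inflation r n \<sigma>"
  shows "shuffle_partition r n (\<lambda>i. leaves (\<sigma> i))"
    and "\<forall>i\<in>{1..r}. std (\<sigma> i) \<in> monomials (card (leaves (\<sigma> i)))"
    and "graft t (\<lambda>i. leaves (\<sigma> i)) (\<lambda>i. std (\<sigma> i)) = subst \<sigma> t"
proof -
  show "shuffle_partition r n (\<lambda>i. leaves (\<sigma> i))"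
    using assms unfolding inflation_def admissible_def shuffle_partition_def by simp
  show "\<forall>i\<in>{1..r}. std (\<sigma> i) \<in> monomials (card (leaves (\<sigma> i)))"
    using assms unfolding inflation_def admissible_def by (simp add: std_in_monomials)
  show "graft t (\<lambda>i. leaves (\<sigma> i)) (\<lambda>i. std (\<sigma> i)) = subst \<sigma> t"
    unfolding graft_def relabel_std ..
qed

lemma inflation_update:
  assumes "inflation r n \<sigma>" "j \<in> {1..r}" "shuffle_tree u" "leaves u = leaves (\<sigma> j)"
  shows "inflation r n (\<sigma>(j := u))"
proof -
  have "leaves ((\<sigma>(j := u)) i) = leaves (\<sigma> i)" for i using assms(4) by simp
  then show ?thesis
    using assms(1,3) unfolding inflation_def admissible_def by simp
qed

section \<open>The path order\<close>

text \<open>The word of letters met on the way from the root to the leaf \<open>l\<close>. The letter \<open>0, 1, 2, 3\<close> stands for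
  left and right below \<open>Prod\<close> and left and right below \<open>Bracket\<close>.\<close>

fun path :: "tree \<Rightarrow> nat \<Rightarrow> nat list" where
  "path (L i) l = []"
| "path (Node g s t) l = ((case g of Prod \<Rightarrow> 0 | Bracket \<Rightarrow> 2) + (if l \<in> leaves s then 0 else 1))
     # (if l \<in> leaves s then path s l else path t l)"

lemma path_subst:
  assumes "shuffle_tree t" "disjoint_family_on (\<lambda>i. leaves (\<sigma> i)) (leaves t)"
    "i \<in> leaves t" "l \<in> leaves (\<sigma> i)"
  shows "path (subst \<sigma> t) l = path t i @ path (\<sigma> i) l"
  using assms
proof (induction t)
  case (L i)
  then show ?case by simp
next
  case (Node g s t)
  have dis: "disjoint_family_on (\<lambda>i. leaves (\<sigma> i)) (leaves s)"
     "disjoint_family_on (\<lambda>i. leaves (\<sigma> i)) (leaves t)"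
    using Node.prems(2) by (auto elim: disjoint_family_on_mono[rotated])
  have iff: "l \<in> leaves (subst \<sigma> s) \<longleftrightarrow> i \<in> leaves s"
  proof
    assume "l \<in> leaves (subst \<sigma> s)"
    then obtain j where j: "j \<in> leaves s" "l \<in> leaves (\<sigma> j)" by (auto simp: leaves_subst)
    then show "i \<in> leaves s"
      using disjoint_family_onD[OF Node.prems(2), of i j] Node.prems(3,4) by (cases "i = j") auto
  qed (use Node.prems(4) in \<open>auto simp: leaves_subst\<close>)
  show ?case using Node dis iff by auto
qed

text \<open>The first letters of the words tell which labels belong to the left subtree, and the remaining
  letters are the words of the two subtrees.\<close>

lemma path_inject:
  "shuffle_tree s \<Longrightarrow> shuffle_tree t \<Longrightarrow> leaves s = leaves t \<Longrightarrow>
    (\<And>l. l \<in> leaves s \<Longrightarrow> path s l = path t l) \<Longrightarrow> s = t"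
proof (induction s arbitrary: t)
  case (L i)
  then show ?case by (cases t) fastforce+
next
  case (Node g s1 s2)
  show ?case
  proof (cases t)
    case (L j)
    then show ?thesis using Node.prems(3,4) by force
  next
    case (Node h t1 t2)
    have eq: "path (Node g s1 s2) l = path (Node h t1 t2) l" if "l \<in> leaves s1 \<union> leaves s2" for l
      using Node.prems(4) that Node by simp
    have gh: "g = h" using eq[of "Min (leaves s1)"]
      by (auto split: gen.splits if_splits)
    have side: "l \<in> leaves s1 \<longleftrightarrow> l \<in> leaves t1" if "l \<in> leaves s1 \<union> leaves s2" for l
      using eq[OF that] gh by (auto split: gen.splits if_splits)
    have un: "leaves s1 \<union> leaves s2 = leaves t1 \<union> leaves t2" using Node.prems(3) Node by simp
    have dis: "leaves s1 \<inter> leaves s2 = {}" "leaves t1 \<inter> leaves t2 = {}"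
      using Node.prems(1,2) Node by auto
    have l1: "leaves s1 = leaves t1" using side un by blast
    have l2: "leaves s2 = leaves t2" using l1 un dis by blast
    have "s1 = t1"
    proof (rule Node.IH(1))
      show "path s1 l = path t1 l" if "l \<in> leaves s1" for l using eq[of l] that l1 by auto
    qed (use Node.prems(1,2) Node l1 in auto)
    moreover have "s2 = t2"
    proof (rule Node.IH(2))
      show "path s2 l = path t2 l" if "l \<in> leaves s2" for l
        using eq[of l] that l1 dis by auto
    qed (use Node.prems(1,2) Node l2 in auto)
    ultimately show ?thesis using Node gh by simp
  qed
qed

definition word_less :: "nat list \<Rightarrow> nat list \<Rightarrow> bool" where
  "word_less v w \<longleftrightarrow> (v, w) \<in> lenlex less_than"

lemma word_less_irrefl [simp]: "\<not> word_less v v"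
  by (simp add: word_less_def lenlex_irreflexive irrefl_less_than[unfolded irrefl_def])

lemma word_less_trans: "word_less u v \<Longrightarrow> word_less v w \<Longrightarrow> word_less u w"
  unfolding word_less_def by (meson lenlex_transI trans_less_than transD)

lemma word_less_linear: "v = w \<or> word_less v w \<or> word_less w v"
  unfolding word_less_def using total_lenlex[OF total_less_than] by (auto simp: total_on_def)

lemma word_less_append_left [simp]: "word_less (u @ v) (u @ w) \<longleftrightarrow> word_less v w"
  by (induction u) (auto simp: word_less_def Cons_lenlex_iff, auto simp: lenlex_conv)

lemma word_less_append_right: "word_less v w \<Longrightarrow> word_less (v @ u) (w @ u)"
  unfolding word_less_def lenlex_conv by (auto intro: lex_append_rightI)

definition path_less :: "tree \<Rightarrow> tree \<Rightarrow> bool" where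
  "path_less s t \<longleftrightarrow> (\<exists>i\<in>leaves s. word_less (path s i) (path t i) \<and>
     (\<forall>j\<in>leaves s. j < i \<longrightarrow> path s j = path t j))"

text \<open>If \<open>s\<close> and \<open>t\<close> first differ at leaf \<open>i\<close>, the grafted trees first differ at the smallest label of
  \<open>\<sigma> i\<close>: every smaller label lies in some \<open>\<sigma> j\<close> with \<open>j < i\<close>, since the minima increase. At this label
  the two words are those of \<open>s\<close> and \<open>t\<close> followed by the same suffix.\<close>

lemma path_less_outer:
  assumes ad: "admissible K \<sigma>" and ls: "leaves s = K" "leaves t = K" "shuffle_tree s" "shuffle_tree t"
    and lt: "path_less s t"
  shows "path_less (subst \<sigma> s) (subst \<sigma> t)"
proof -
  have dis: "disjoint_family_on (\<lambda>i. leaves (\<sigma> i)) K"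
    and mono: "strict_mono_on K (\<lambda>i. Min (leaves (\<sigma> i)))"
    using ad by (auto simp: admissible_def)
  obtain i where i: "i \<in> K" "word_less (path s i) (path t i)"
    "\<And>j. j \<in> K \<Longrightarrow> j < i \<Longrightarrow> path s j = path t j"
    using lt ls by (auto simp: path_less_def)
  have P: "path (subst \<sigma> u) l = path u j @ path (\<sigma> j) l" if "j \<in> K" "l \<in> leaves (\<sigma> j)" "u \<in> {s, t}" for u j l
    using path_subst[of u \<sigma> j l] that dis ls by auto
  let ?l = "Min (leaves (\<sigma> i))"
  have l: "?l \<in> leaves (\<sigma> i)" by simp
  show ?thesis
    unfolding path_less_def
  proof (intro bexI[of _ ?l] conjI ballI impI)
    show "word_less (path (subst \<sigma> s) ?l) (path (subst \<sigma> t) ?l)"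
      using P[OF i(1) l] i(2) by (auto intro: word_less_append_right)
    show "?l \<in> leaves (subst \<sigma> s)" using i(1) ls l by (auto simp: leaves_subst simp del: Min_in)
    fix q assume q: "q \<in> leaves (subst \<sigma> s)" "q < ?l"
    then obtain j where j: "j \<in> K" "q \<in> leaves (\<sigma> j)" using ls by (auto simp: leaves_subst)
    have "Min (leaves (\<sigma> j)) \<le> q" using j(2) by simp
    then have "Min (leaves (\<sigma> j)) < ?l" using q(2) by (rule le_less_trans)
    then have "j < i" using strict_mono_on_less[OF mono] i(1) j(1) by blast
    then show "path (subst \<sigma> s) q = path (subst \<sigma> t) q"
      using P[OF j] i(3) j(1) by simp
  qed
qed

text \<open>Here the words at labels of the exchanged tree get a common prefix, and all other words agree.\<close>

lemma path_less_inner: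
  assumes inf: "inflation r n \<sigma>" and t: "t \<in> monomials r" and j: "j \<in> {1..r}"
    and u: "shuffle_tree u" "leaves u = leaves (\<sigma> j)" and lt: "path_less (\<sigma> j) u"
  shows "path_less (subst \<sigma> t) (subst (\<sigma>(j := u)) t)"
proof -
  have ls: "leaves t = {1..r}" "shuffle_tree t"
    using t by (auto simp: monomials_def)
  have "inflation r n (\<sigma>(j := u))" by (intro inflation_update inf j u)
  then have dis: "disjoint_family_on (\<lambda>i. leaves (\<sigma> i)) {1..r}"
     "disjoint_family_on (\<lambda>i. leaves ((\<sigma>(j := u)) i)) {1..r}"
    using inf unfolding inflation_def admissible_def by blast+
  obtain l where l: "l \<in> leaves (\<sigma> j)" "word_less (path (\<sigma> j) l) (path u l)"
    "\<And>q. q \<in> leaves (\<sigma> j) \<Longrightarrow> q < l \<Longrightarrow> path (\<sigma> j) q = path u q"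
    using lt by (auto simp: path_less_def)
  have P: "path (subst \<sigma> t) q = path t i @ path (\<sigma> i) q"
     "path (subst (\<sigma>(j := u)) t) q = path t i @ path ((\<sigma>(j := u)) i) q"
    if "i \<in> {1..r}" "q \<in> leaves (\<sigma> i)" for i q
    using path_subst[of t \<sigma> i q] path_subst[of t "\<sigma>(j := u)" i q] that dis ls u(2) by auto
  show ?thesis
    unfolding path_less_def
  proof (intro bexI[of _ l] conjI ballI impI)
    show "word_less (path (subst \<sigma> t) l) (path (subst (\<sigma>(j := u)) t) l)"
      using P[OF j l(1)] l(2) by simp
    show "l \<in> leaves (subst \<sigma> t)" using j l(1) ls by (auto simp: leaves_subst)
    fix q assume q: "q \<in> leaves (subst \<sigma> t)" "q < l"
    then obtain i where i: "i \<in> {1..r}" "q \<in> leaves (\<sigma> i)" using ls by (auto simp: leaves_subst)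
    show "path (subst \<sigma> t) q = path (subst (\<sigma>(j := u)) t) q"
      using P[OF i] l(3)[of q] i q(2) by auto
  qed
qed

lemma path_less_linear:
  assumes "shuffle_tree s" "shuffle_tree t" "leaves s = leaves t" "s \<noteq> t"
  shows "path_less s t \<or> path_less t s"
proof -
  let ?D = "{l\<in>leaves s. path s l \<noteq> path t l}"
  have "?D \<noteq> {}" using path_inject assms by blast
  then have M: "Min ?D \<in> ?D" by (intro Min_in) auto
  define i where "i = Min ?D"
  have i: "i \<in> leaves s" "path s i \<noteq> path t i" using M by (auto simp: i_def)
  have "path s j = path t j" if "j \<in> leaves s" "j < i" for j
  proof (rule ccontr)
    assume "path s j \<noteq> path t j"
    then have "i \<le> j" using that(1) unfolding i_def by (intro Min_le) auto
    with that(2) show False by simp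
  qed
  then show ?thesis
    using i assms(3) word_less_linear[of "path s i" "path t i"] unfolding path_less_def by metis
qed

lemma path_less_trans:
  assumes "path_less s t" "path_less t u" "leaves s = leaves t"
  shows "path_less s u"
proof -
  obtain i where i: "i \<in> leaves s" "word_less (path s i) (path t i)"
    "\<And>j. j \<in> leaves s \<Longrightarrow> j < i \<Longrightarrow> path s j = path t j"
    using assms by (auto simp: path_less_def)
  obtain k where k: "k \<in> leaves s" "word_less (path t k) (path u k)"
    "\<And>j. j \<in> leaves s \<Longrightarrow> j < k \<Longrightarrow> path t j = path u j"
    using assms by (auto simp: path_less_def)
  have "word_less (path s (min i k)) (path u (min i k))"
    using i k word_less_trans by (cases i k rule: linorder_cases) (fastforce simp: min_def)+
  moreover have "min i k \<in> leaves s" using i k by (simp add: min_def)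
  ultimately show ?thesis unfolding path_less_def using i(3) k(3) by (intro bexI[of _ "min i k"]) auto
qed

lemma monomial_order_path_less: "monomial_order path_less"
  unfolding monomial_order_def
proof (intro conjI allI impI)
  fix n
  show "irreflp_on (monomials n) path_less"
    by (rule irreflp_onI) (auto simp: path_less_def)
  show "transp_on (monomials n) path_less"
    by (rule transp_onI) (auto simp: monomials_def intro: path_less_trans)
  show "totalp_on (monomials n) path_less"
    by (rule totalp_onI) (simp add: monomials_def path_less_linear)
next
  fix r n I s t m
  assume "shuffle_partition r n I" "s \<in> monomials r" "t \<in> monomials r"
    "\<forall>i\<in>{1..r}. m i \<in> monomials (card (I i))" "path_less s t"
  then show "path_less (graft s I m) (graft t I m)"
    unfolding graft_def using graft_inflation(1)
    by (intro path_less_outer[of "{1..r}"]) (auto simp: inflation_def monomials_def)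
next
  fix r n I t m j u
  assume sp: "shuffle_partition r n I" and t: "t \<in> monomials r"
    and m: "\<forall>i\<in>{1..r}. m i \<in> monomials (card (I i))" and j: "j \<in> {1..r}"
    and u: "u \<in> monomials (card (I j))" and lt: "path_less (m j) u"
  let ?\<sigma> = "\<lambda>i. relabel (I i) (m i)"
  have fin: "finite (I j)"
    using j sp unfolding shuffle_partition_def by (metis UN_upper finite_atLeastAtMost finite_subset)
  have mj: "m j \<in> monomials (card (I j))" using m j by blast
  have "path_less (relabel (I j) (m j)) (relabel (I j) u)"
    using mj u lt by (intro path_less_outer[of "{1..card (I j)}"] admissible_labels
      strict_mono_on_nth_sorted_list) (auto simp: monomials_def)
  then have "path_less (subst ?\<sigma> t) (subst (?\<sigma>(j := relabel (I j) u)) t)"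
    using graft_inflation[OF sp m] relabel_monomial[OF u fin] t j
    by (intro path_less_inner[of r n]) auto
  moreover have "(\<lambda>i. relabel (I i) ((m(j := u)) i)) = ?\<sigma>(j := relabel (I j) u)" by auto
  ultimately show "path_less (graft t I m) (graft t I (m(j := u)))"
    unfolding graft_def by simp
qed

section \<open>Linear extension\<close>

lemma lookup_scale [simp]: "Poly_Mapping.lookup (scale c f) t = c * Poly_Mapping.lookup f t"
  by (simp add: scale_def Poly_Mapping.map.rep_eq when_def)

lemma keys_scale: "Poly_Mapping.keys (scale c f) \<subseteq> Poly_Mapping.keys f"
  by (auto simp: in_keys_iff)

definition lin :: "(tree \<Rightarrow> tree) \<Rightarrow> (tree \<Rightarrow>\<^sub>0 'k::field) \<Rightarrow> (tree \<Rightarrow>\<^sub>0 'k)" where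
  "lin h f = (\<Sum>t\<in>Poly_Mapping.keys f. Poly_Mapping.lookup f t \<odot> h t)"

lemma lin_superset:
  "finite A \<Longrightarrow> Poly_Mapping.keys f \<subseteq> A \<Longrightarrow> lin h f = (\<Sum>t\<in>A. Poly_Mapping.lookup f t \<odot> h t)"
  unfolding lin_def by (rule sum.mono_neutral_left) (auto simp: in_keys_iff)

lemma lin_add [simp]: "lin h (f + g) = lin h f + lin h g"
proof -
  let ?A = "Poly_Mapping.keys f \<union> Poly_Mapping.keys g"
  have "lin h (f + g) = (\<Sum>t\<in>?A. Poly_Mapping.lookup (f + g) t \<odot> h t)"
    by (rule lin_superset) (auto simp: Poly_Mapping.keys_add)
  also have "\<dots> = lin h f + lin h g"
    by (simp add: lin_superset[of ?A f] lin_superset[of ?A g] lookup_add single_add sum.distrib)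
  finally show ?thesis .
qed

lemma lin_uminus [simp]: "lin h (- f) = - lin h f"
  by (simp add: lin_def single_uminus sum_negf)

lemma lin_diff [simp]: "lin h (f - g) = lin h f - lin h g"
  using lin_add[of h f "- g"] by simp

lemma lin_single [simp]: "lin h (c \<odot> t) = c \<odot> h t"
  by (cases "c = 0") (simp_all add: lin_def)

lemma lin_cong: "(\<And>t. t \<in> Poly_Mapping.keys f \<Longrightarrow> h t = h' t) \<Longrightarrow> lin h f = lin h' f"
  by (simp add: lin_def)

lemma keys_lin: "Poly_Mapping.keys (lin h f) \<subseteq> h ` Poly_Mapping.keys f"
  unfolding lin_def by (rule order_trans[OF Poly_Mapping.keys_sum]) (auto split: if_splits)

section \<open>Composition with monomials\<close>

lemma graft_cong:
  "t \<in> monomials r \<Longrightarrow> (\<And>i. i \<in> {1..r} \<Longrightarrow> m i = m' i) \<Longrightarrow> graft t I m = graft t I m'"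
  unfolding graft_def by (rule subst_cong) (auto simp: monomials_def)

lemma compose_monomials:
  assumes "Poly_Mapping.keys f \<subseteq> monomials r"
  shows "compose r I f (\<lambda>i. 1 \<odot> m i) = lin (\<lambda>t. graft t I m) f"
proof -
  have "(\<Pi>\<^sub>E i\<in>{1..r}. {m i}) = (\<Pi>\<^sub>E i\<in>{1..r}. {restrict m {1..r} i})"
    by (rule PiE_cong) simp
  also have "\<dots> = {restrict m {1..r}}"
    by (rule PiE_singleton) (rule restrict_extensional)
  finally have PiE: "(\<Pi>\<^sub>E i\<in>{1..r}. {m i}) = {restrict m {1..r}}" .
  then have "compose r I f (\<lambda>i. 1 \<odot> m i) =
      (\<Sum>t\<in>Poly_Mapping.keys f. Poly_Mapping.lookup f t \<odot> graft t I (restrict m {1..r}))"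
    by (simp add: compose_def PiE)
  also have "\<dots> = lin (\<lambda>t. graft t I m) f"
    unfolding lin_def using assms by (intro sum.cong refl arg_cong2[of _ _ _ _ "\<lambda>t c. c \<odot> t"] graft_cong[of _ r]) auto
  finally show ?thesis .
qed

text \<open>With all inputs but the \<open>j\<close>-th being monomials, a choice of monomials for the inputs is the same as
  the choice of one monomial of \<open>f\<close>.\<close>

lemma compose_into_monomial:
  assumes t: "t \<in> monomials r" and j: "j \<in> {1..r}"
  shows "compose r I (1 \<odot> t) ((\<lambda>i. 1 \<odot> m i)(j := f)) = lin (\<lambda>u. graft t I (m(j := u))) f"
proof -
  let ?b = "(\<lambda>i. 1 \<odot> m i)(j := f)"
  let ?h = "\<lambda>u. restrict (m(j := u)) {1..r}"
  have PiE: "(\<Pi>\<^sub>E i\<in>{1..r}. Poly_Mapping.keys (?b i)) = ?h ` Poly_Mapping.keys f"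
  proof (intro equalityI subsetI)
    fix m' assume m': "m' \<in> (\<Pi>\<^sub>E i\<in>{1..r}. Poly_Mapping.keys (?b i))"
    have "m' = ?h (m' j)"
    proof
      fix i show "m' i = ?h (m' j) i"
        using PiE_mem[OF m', of i] PiE_arb[OF m', of i] by (auto split: if_splits)
    qed
    moreover have "m' j \<in> Poly_Mapping.keys f" using PiE_mem[OF m' j] by simp
    ultimately show "m' \<in> ?h ` Poly_Mapping.keys f" by blast
  qed (auto simp: PiE_iff)
  have inj: "inj_on ?h (Poly_Mapping.keys f)"
    by (rule inj_onI) (use j in \<open>metis fun_upd_same restrict_apply'\<close>)
  have coeff: "(\<Prod>i\<in>{1..r}. Poly_Mapping.lookup (?b i) (?h u i)) = Poly_Mapping.lookup f u" for u
  proof -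
    have "(\<Prod>i\<in>{1..r}. Poly_Mapping.lookup (?b i) (?h u i)) =
        (\<Prod>i\<in>{1..r}. if i = j then Poly_Mapping.lookup f u else 1)"
      by (rule prod.cong) auto
    then show ?thesis using j by simp
  qed
  have "compose r I (1 \<odot> t) ?b = (\<Sum>u\<in>Poly_Mapping.keys f. Poly_Mapping.lookup f u \<odot> graft t I (?h u))"
    by (simp add: compose_def PiE sum.reindex[OF inj] coeff del: fun_upd_apply restrict_apply)
  also have "\<dots> = lin (\<lambda>u. graft t I (m(j := u))) f"
    unfolding lin_def using t by (intro sum.cong refl arg_cong2[of _ _ _ _ "\<lambda>t c. c \<odot> t"] graft_cong[of _ r]) auto
  finally show ?thesis .
qed

section \<open>The ideal is closed under substitution\<close>

lemma keys_compose:
  "Poly_Mapping.keys (compose r I f b) \<subseteq>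
    {graft t I m | t m. t \<in> Poly_Mapping.keys f \<and> (\<forall>i\<in>{1..r}. m i \<in> Poly_Mapping.keys (b i))}"
proof -
  have "Poly_Mapping.keys (compose r I f b) \<subseteq>
    (\<Union>t\<in>Poly_Mapping.keys f. \<Union>m\<in>(\<Pi>\<^sub>E i\<in>{1..r}. Poly_Mapping.keys (b i)). {graft t I m})"
    unfolding compose_def
    by (intro order_trans[OF Poly_Mapping.keys_sum] UN_mono order_refl) auto
  then show ?thesis by (auto simp: PiE_iff) blast
qed

lemma compose_free:
  assumes "f \<in> free_operad r" "shuffle_partition r n I" "\<And>i. i \<in> {1..r} \<Longrightarrow> b i \<in> free_operad (card (I i))"
  shows "compose r I f b \<in> free_operad n"
  using keys_compose[of r I f b] assms graft_in_monomials[OF assms(2)]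
  unfolding free_operad_def by fast

lemma in_ideal_free: "in_ideal R n f \<Longrightarrow> f \<in> free_operad n"
proof (induction rule: in_ideal.induct)
  case (add n f g)
  then show ?case using Poly_Mapping.keys_add[of f g] by (auto simp: free_operad_def)
next
  case (scale n f c)
  then show ?case using keys_scale[of c f] by (auto simp: free_operad_def)
qed (auto intro: compose_free, simp add: free_operad_def)

lemma ideal_free: "ideal R n \<subseteq> free_operad n"
  using in_ideal_free by (auto simp: ideal_def)

lemma ideal_add: "f \<in> ideal R n \<Longrightarrow> g \<in> ideal R n \<Longrightarrow> f + g \<in> ideal R n"
  and ideal_scale: "f \<in> ideal R n \<Longrightarrow> scale c f \<in> ideal R n"
  by (auto simp: ideal_def intro: in_ideal.intros)

lemma scale_minus_one [simp]: "scale (- 1) f = - f"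
  by (rule poly_mapping_eqI) simp

lemma ideal_uminus: "f \<in> ideal R n \<Longrightarrow> - f \<in> ideal R n"
  using ideal_scale[of f R n "- 1"] by simp

lemma ideal_diff: "f \<in> ideal R n \<Longrightarrow> g \<in> ideal R n \<Longrightarrow> f - g \<in> ideal R n"
  using ideal_add[OF _ ideal_uminus] by fastforce

lemma ideal_outer:
  assumes f: "f \<in> ideal R r" and inf: "inflation r n \<sigma>"
  shows "lin (subst \<sigma>) f \<in> ideal R n"
proof -
  have "compose r (\<lambda>i. leaves (\<sigma> i)) f (\<lambda>i. 1 \<odot> std (\<sigma> i)) \<in> ideal R n"
    using f inflation_graft[OF inf] unfolding ideal_def
    by (auto intro!: in_ideal.compose_outer simp: free_operad_def)
  moreover have "Poly_Mapping.keys f \<subseteq> monomials r"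
    using f ideal_free by (auto simp: free_operad_def)
  ultimately show ?thesis
    by (simp add: compose_monomials inflation_graft(3)[OF inf])
qed

lemma graft_inner:
  assumes inf: "inflation r n \<sigma>" and t: "t \<in> monomials r" and j: "j \<in> {1..r}"
    and e: "strict_mono_on {1..k} e" "e ` {1..k} = leaves (\<sigma> j)" and u: "u \<in> monomials k"
  shows "graft t (\<lambda>i. leaves (\<sigma> i)) ((\<lambda>i. std (\<sigma> i))(j := u)) =
    subst (\<sigma>(j := subst (\<lambda>l. L (e l)) u)) t"
proof -
  have "subst (\<lambda>l. L (e l)) u = relabel (leaves (\<sigma> j)) u"
  proof (rule subst_cong)
    fix l assume "l \<in> leaves u"
    then have l: "l \<in> {1..k}" using u by (simp add: monomials_def)
    have "rank (leaves (\<sigma> j)) (e l) = l"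
      using rank_strict_mono_image[OF _ e(1) l] l by (simp add: e(2))
    moreover have "e l \<in> leaves (\<sigma> j)" using l e(2) by blast
    ultimately show "L (e l) = L (sorted_list_of_set (leaves (\<sigma> j)) ! (l - 1))"
      using nth_rank[of "leaves (\<sigma> j)" "e l"] by simp
  qed
  then show ?thesis
    unfolding graft_def by (intro arg_cong2[of _ _ _ _ subst] refl ext) (simp add: relabel_std)
qed

lemma card_strict_mono_image: "strict_mono_on {1..k} (e :: nat \<Rightarrow> nat) \<Longrightarrow> e ` {1..k} = A \<Longrightarrow> card A = k"
  using card_image[OF strict_mono_on_imp_inj_on, of "{1..k}" e] by auto

text \<open>The tree \<open>\<sigma> j\<close> only serves to fix the set of labels of the \<open>j\<close>-th input; it is replaced by the
  elements of the ideal, transported along the increasing map \<open>e\<close>.\<close>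

lemma ideal_inner:
  assumes f: "f \<in> ideal R k" and inf: "inflation r n \<sigma>" and t: "t \<in> monomials r" and j: "j \<in> {1..r}"
    and e: "strict_mono_on {1..k} e" "e ` {1..k} = leaves (\<sigma> j)"
  shows "lin (\<lambda>u. subst (\<sigma>(j := subst (\<lambda>l. L (e l)) u)) t) f \<in> ideal R n"
proof -
  have card: "card (leaves (\<sigma> j)) = k" using card_strict_mono_image[OF e] .
  have free: "f \<in> free_operad k" using f ideal_free by blast
  have "compose r (\<lambda>i. leaves (\<sigma> i)) (1 \<odot> t) ((\<lambda>i. 1 \<odot> std (\<sigma> i))(j := f)) \<in> ideal R n"
    unfolding ideal_def mem_Collect_eq
  proof (rule in_ideal.compose_inner[OF _ inflation_graft(1)[OF inf] _ j])
    show "1 \<odot> t \<in> free_operad r" using t by (simp add: free_operad_def)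
    show "in_ideal R (card (leaves (\<sigma> j))) (((\<lambda>i. 1 \<odot> std (\<sigma> i))(j := f)) j)"
      using f card by (simp add: ideal_def)
    show "((\<lambda>i. 1 \<odot> std (\<sigma> i))(j := f)) i \<in> free_operad (card (leaves (\<sigma> i)))" if "i \<in> {1..r}" for i
      using inflation_graft(2)[OF inf] that free card by (auto simp: free_operad_def)
  qed
  also have "compose r (\<lambda>i. leaves (\<sigma> i)) (1 \<odot> t) ((\<lambda>i. 1 \<odot> std (\<sigma> i))(j := f)) =
      lin (\<lambda>u. subst (\<sigma>(j := subst (\<lambda>l. L (e l)) u)) t) f"
    unfolding compose_into_monomial[OF t j]
    using free by (intro lin_cong graft_inner[OF inf t j e]) (auto simp: free_operad_def)
  finally show ?thesis .
qed

section \<open>Leading monomials\<close>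

text \<open>A map that preserves the comparisons with the leading monomial cannot cancel its coefficient,
  because no other monomial has the same image.\<close>

lemma is_leading_lin:
  assumes lead: "is_leading lt f s" and mono: "\<And>t. t \<in> Poly_Mapping.keys f \<Longrightarrow> lt t s \<Longrightarrow> lt (h t) (h s)"
    and irr: "\<not> lt (h s) (h s)"
  shows "is_leading lt (lin h f) (h s)"
proof -
  have ne: "h t \<noteq> h s" and less: "lt (h t) (h s)" if "t \<in> Poly_Mapping.keys f" "t \<noteq> s" for t
    using that mono lead irr by (force simp: is_leading_def)+
  have s: "s \<in> Poly_Mapping.keys f" using lead by (simp add: is_leading_def)
  have "Poly_Mapping.lookup (lin h f) (h s) =
      (\<Sum>t\<in>Poly_Mapping.keys f. Poly_Mapping.lookup f t when h t = h s)"
    by (simp add: lin_def lookup_sum lookup_single)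
  also have "\<dots> = (\<Sum>t\<in>Poly_Mapping.keys f. if t = s then Poly_Mapping.lookup f s else 0)"
    by (rule sum.cong) (use ne in \<open>auto simp: when_def\<close>)
  also have "\<dots> = Poly_Mapping.lookup f s"
    using s by simp
  finally have "h s \<in> Poly_Mapping.keys (lin h f)"
    using s by (simp add: in_keys_iff)
  then show ?thesis
    unfolding is_leading_def using keys_lin[of h f] less by blast
qed

context
  fixes lt :: "tree \<Rightarrow> tree \<Rightarrow> bool"
  assumes mo: "monomial_order lt"
begin

lemma lt_irrefl: "t \<in> monomials n \<Longrightarrow> \<not> lt t t"
  using mo unfolding monomial_order_def by (meson irreflp_onD)

lemma lt_trans: "s \<in> monomials n \<Longrightarrow> t \<in> monomials n \<Longrightarrow> u \<in> monomials n \<Longrightarrow> lt s t \<Longrightarrow> lt t u \<Longrightarrow> lt s u"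
  using mo unfolding monomial_order_def by (meson transp_onD)

lemma lt_total: "s \<in> monomials n \<Longrightarrow> t \<in> monomials n \<Longrightarrow> s \<noteq> t \<Longrightarrow> lt s t \<or> lt t s"
  using mo unfolding monomial_order_def totalp_on_def by blast

lemma lt_outer:
  assumes "inflation r n \<sigma>" "s \<in> monomials r" "t \<in> monomials r" "lt s t"
  shows "lt (subst \<sigma> s) (subst \<sigma> t)"
proof -
  have "\<forall>r n I s t m. shuffle_partition r n I \<longrightarrow> s \<in> monomials r \<longrightarrow> t \<in> monomials r \<longrightarrow>
        (\<forall>i\<in>{1..r}. m i \<in> monomials (card (I i))) \<longrightarrow> lt s t \<longrightarrow> lt (graft s I m) (graft t I m)"
    using mo unfolding monomial_order_def by (elim conjE)
  from this[rule_format, OF inflation_graft(1)[OF assms(1)] assms(2,3) _ assms(4), of "\<lambda>i. std (\<sigma> i)"]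
  show ?thesis using inflation_graft(2,3)[OF assms(1)] by simp
qed

lemma lt_inner:
  assumes inf: "inflation r n \<sigma>" and t: "t \<in> monomials r" and j: "j \<in> {1..r}"
    and e: "strict_mono_on {1..k} e" "e ` {1..k} = leaves (\<sigma> j)"
    and u: "u \<in> monomials k" "v \<in> monomials k" "lt u v"
  shows "lt (subst (\<sigma>(j := subst (\<lambda>l. L (e l)) u)) t) (subst (\<sigma>(j := subst (\<lambda>l. L (e l)) v)) t)"
proof -
  have *: "\<forall>r n I t m j u. shuffle_partition r n I \<longrightarrow> t \<in> monomials r \<longrightarrow>
        (\<forall>i\<in>{1..r}. m i \<in> monomials (card (I i))) \<longrightarrow>
        j \<in> {1..r} \<longrightarrow> u \<in> monomials (card (I j)) \<longrightarrow>
        lt (m j) u \<longrightarrow> lt (graft t I m) (graft t I (m(j := u)))"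
    using mo unfolding monomial_order_def by (elim conjE)
  let ?m = "(\<lambda>i. std (\<sigma> i))(j := u)"
  have card: "card (leaves (\<sigma> j)) = k" using card_strict_mono_image[OF e] .
  have "lt (graft t (\<lambda>i. leaves (\<sigma> i)) ?m) (graft t (\<lambda>i. leaves (\<sigma> i)) (?m(j := v)))"
    by (rule *[rule_format, OF inflation_graft(1)[OF inf] t _ j])
      (use u card inflation_graft(2)[OF inf] in auto)
  then show ?thesis using graft_inner[OF inf t j e] u by simp
qed

lemma greatest_monomial:
  "finite A \<Longrightarrow> A \<noteq> {} \<Longrightarrow> A \<subseteq> monomials n \<Longrightarrow> \<exists>t\<in>A. \<forall>s\<in>A. s \<noteq> t \<longrightarrow> lt s t"
proof (induction rule: finite_ne_induct)
    case (insert x A)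
    then obtain t where t: "t \<in> A" "\<And>s. s \<in> A \<Longrightarrow> s \<noteq> t \<Longrightarrow> lt s t" by blast
    have "x \<noteq> t" using t insert by blast
    then consider "lt x t" | "lt t x" using lt_total[of x n t] insert t by blast
    then show ?case
    proof cases
      case 1
      then show ?thesis using t by blast
    next
      case 2
      then have "lt s x" if "s \<in> A" for s
        using t(2)[OF that] lt_trans[of s n t x] that t(1) insert.prems by (cases "s = t") auto
      then show ?thesis by blast
    qed
  qed simp

lemma leading_exists:
  assumes "f \<in> free_operad n" "f \<noteq> 0"
  shows "\<exists>t. is_leading lt f t"
  using greatest_monomial[of "Poly_Mapping.keys f" n] assms unfolding is_leading_def free_operad_def by auto

end

section \<open>Divisibility\<close>

lemma admissible_of_shuffle_subst:
  "shuffle_tree (subst \<sigma> s) \<Longrightarrow> shuffle_tree s \<Longrightarrow>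
    (\<forall>i\<in>leaves s. shuffle_tree (\<sigma> i)) \<and> disjoint_family_on (\<lambda>i. leaves (\<sigma> i)) (leaves s)"
proof (induction s)
  case (Node g s t)
  have *: "leaves (\<sigma> i) \<inter> leaves (\<sigma> j) = {}" if "i \<in> leaves s" "j \<in> leaves t" for i j
    using Node.prems(1) that by (auto simp: leaves_subst)
  then have "leaves (\<sigma> j) \<inter> leaves (\<sigma> i) = {}" if "i \<in> leaves s" "j \<in> leaves t" for i j
    using that by (simp add: Int_commute)
  with * show ?case using Node unfolding disjoint_family_on_def
    by (simp add: ball_Un)
qed (simp add: disjoint_family_on_def)

text \<open>A family covering an arbitrary label set becomes an inflation after relabelling the whole family by
  the increasing bijection onto an initial segment.\<close>

lemma inflation_standardise:
  assumes ad: "admissible {1..r} \<sigma>" and S: "S = (\<Union>i\<in>{1..r}. leaves (\<sigma> i))"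
  shows "inflation r (card S) (\<lambda>i. subst (\<lambda>l. L (rank S l)) (\<sigma> i))"
proof -
  have fin: "finite S" by (simp add: S)
  have mono: "strict_mono_on S (rank S)" by (rule strict_mono_on_rank[OF fin])
  have sub: "leaves (\<sigma> i) \<subseteq> S" if "i \<in> {1..r}" for i using that S by blast
  have sh: "shuffle_tree (subst (\<lambda>l. L (rank S l)) (\<sigma> i))"
    "Min (leaves (subst (\<lambda>l. L (rank S l)) (\<sigma> i))) = rank S (Min (leaves (\<sigma> i)))"
    if "i \<in> {1..r}" for i
    using shuffle_tree_subst[OF _ admissible_labels[OF monotone_on_subset[OF mono sub[OF that]]]] ad that
    by (auto simp: admissible_def)
  have lv: "leaves (subst (\<lambda>l. L (rank S l)) (\<sigma> i)) = rank S ` leaves (\<sigma> i)" for i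
    by (auto simp: leaves_subst)
  have dis: "rank S ` leaves (\<sigma> i) \<inter> rank S ` leaves (\<sigma> j) = {}" if "i \<in> {1..r}" "j \<in> {1..r}" "i \<noteq> j" for i j
    using inj_on_image_Int[OF strict_mono_on_imp_inj_on[OF mono] sub sub, of i j] that ad
    by (auto simp: admissible_def disjoint_family_on_def)
  have Min: "rank S (Min (leaves (\<sigma> i))) < rank S (Min (leaves (\<sigma> j)))" if "i \<in> {1..r}" "j \<in> {1..r}" "i < j" for i j
  proof (rule strict_mono_onD[OF mono])
    show "Min (leaves (\<sigma> i)) < Min (leaves (\<sigma> j))"
      using ad that unfolding admissible_def by (meson strict_mono_onD)
  qed (use sub that Min_in[OF finite_leaves leaves_nonempty] in blast)+
  have "(\<Union>i\<in>{1..r}. rank S ` leaves (\<sigma> i)) = rank S ` S" unfolding S by blast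
  then show ?thesis
    unfolding inflation_def admissible_def lv
    using sh dis Min rank_image[OF fin] lv by (simp add: disjoint_family_on_def strict_mono_on_def)
qed

text \<open>The induction on the position of a divisor runs through subtrees, whose labels are not an initial
  segment; the property of being a leading monomial of the ideal is therefore stated up to
  standardisation.\<close>

definition std_is_leading :: "(tree \<Rightarrow> tree \<Rightarrow> bool) \<Rightarrow> (tree \<Rightarrow>\<^sub>0 'k::field) set \<Rightarrow> tree \<Rightarrow> bool" where
  "std_is_leading lt R u \<longleftrightarrow> (\<exists>g\<in>ideal R (card (leaves u)). is_leading lt g (std u))"

lemma std_subst:
  "S = leaves (subst \<sigma> t) \<Longrightarrow> std (subst \<sigma> t) = subst (\<lambda>i. subst (\<lambda>l. L (rank S l)) (\<sigma> i)) t"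
  by (simp add: std_def subst_subst)

lemma leaves_subst_monomial: "t \<in> monomials r \<Longrightarrow> leaves (subst \<sigma> t) = (\<Union>i\<in>{1..r}. leaves (\<sigma> i))"
  by (auto simp: leaves_subst monomials_def)

lemma std_is_leading_subst:
  assumes mo: "monomial_order lt" and g: "g \<in> ideal R r" "is_leading lt g s" and s: "s \<in> monomials r"
    and ad: "admissible {1..r} \<sigma>"
  shows "std_is_leading lt R (subst \<sigma> s)"
proof -
  let ?S = "leaves (subst \<sigma> s)"
  let ?\<tau> = "\<lambda>i. subst (\<lambda>l. L (rank ?S l)) (\<sigma> i)"
  have inf: "inflation r (card ?S) ?\<tau>"
    by (rule inflation_standardise[OF ad leaves_subst_monomial[OF s]])
  have keys: "Poly_Mapping.keys g \<subseteq> monomials r"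
    using g ideal_free by (auto simp: free_operad_def)
  have "is_leading lt (lin (subst ?\<tau>) g) (subst ?\<tau> s)"
    using keys s lt_irrefl[OF mo subst_inflation[OF inf s]]
    by (intro is_leading_lin[OF g(2)] lt_outer[OF mo inf]) auto
  then show ?thesis
    unfolding std_is_leading_def std_subst[OF refl] using ideal_outer[OF g(1) inf] by blast
qed

lemma std_is_leading_context:
  assumes mo: "monomial_order lt" and red: "std_is_leading lt R (\<sigma> j)" and t: "t \<in> monomials r"
    and ad: "admissible {1..r} \<sigma>" and j: "j \<in> {1..r}"
  shows "std_is_leading lt R (subst \<sigma> t)"
proof -
  let ?S = "leaves (subst \<sigma> t)"
  define \<tau> where "\<tau> = (\<lambda>i. subst (\<lambda>l. L (rank ?S l)) (\<sigma> i))"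
  have inf: "inflation r (card ?S) \<tau>"
    unfolding \<tau>_def by (rule inflation_standardise[OF ad leaves_subst_monomial[OF t]])
  have "leaves (\<sigma> j) \<subseteq> ?S" using j leaves_subst_monomial[OF t] by blast
  then have mono: "strict_mono_on (leaves (\<sigma> j)) (rank ?S)"
    using strict_mono_on_rank[of ?S] by (simp add: monotone_on_subset)
  let ?k = "card (leaves (\<sigma> j))"
  have std: "std (\<tau> j) = std (\<sigma> j)" unfolding \<tau>_def by (rule std_relabel[OF mono])
  have "leaves (\<tau> j) = rank ?S ` leaves (\<sigma> j)" by (auto simp: \<tau>_def leaves_subst)
  then have k: "card (leaves (\<tau> j)) = ?k" using strict_mono_on_imp_inj_on[OF mono] by (simp add: card_image)
  define e where "e = (\<lambda>l. sorted_list_of_set (leaves (\<tau> j)) ! (l - 1))"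
  have e: "strict_mono_on {1..?k} e" "e ` {1..?k} = leaves (\<tau> j)"
    unfolding e_def k[symmetric] by (rule strict_mono_on_nth_sorted_list image_nth_sorted_list finite_leaves)+
  have restore: "subst (\<lambda>l. L (e l)) (std (\<sigma> j)) = \<tau> j"
    unfolding e_def std[symmetric] by (rule relabel_std)
  obtain g where g: "g \<in> ideal R ?k" "is_leading lt g (std (\<sigma> j))"
    using red unfolding std_is_leading_def by blast
  have keys: "Poly_Mapping.keys g \<subseteq> monomials ?k"
    using g ideal_free by (auto simp: free_operad_def)
  have sj: "std (\<sigma> j) \<in> monomials ?k"
    using keys g(2) by (auto simp: is_leading_def)
  let ?h = "\<lambda>u. subst (\<tau>(j := subst (\<lambda>l. L (e l)) u)) t"
  have h: "?h (std (\<sigma> j)) = std (subst \<sigma> t)"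
    unfolding restore fun_upd_triv by (simp add: std_subst[OF refl] \<tau>_def)
  have "std (subst \<sigma> t) \<in> monomials (card ?S)"
    using subst_inflation[OF inf t] by (simp add: std_subst[OF refl] \<tau>_def)
  then have "is_leading lt (lin ?h g) (?h (std (\<sigma> j)))"
    using keys sj lt_irrefl[OF mo]
    by (intro is_leading_lin[OF g(2)] lt_inner[OF mo inf t j e]) (auto simp: h)
  then show ?thesis
    unfolding std_is_leading_def using ideal_inner[OF g(1) inf t j e] h by auto
qed

lemma std_is_leading_supertree:
  assumes mo: "monomial_order lt"
  shows "u \<in> subtrees t \<Longrightarrow> shuffle_tree t \<Longrightarrow> std_is_leading lt R u \<Longrightarrow> std_is_leading lt R t"
proof (induction t)
  case (Node g s t)
  let ?\<sigma> = "\<lambda>i::nat. if i = 1 then s else t"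
  have two: "{1..2::nat} = {1, 2}" by auto
  have t0: "Node g (L 1) (L 2) \<in> monomials 2" by (auto simp: monomials_def)
  have ad: "admissible {1..2} ?\<sigma>"
    using Node.prems(2) unfolding admissible_def two by (auto simp: disjoint_family_on_def strict_mono_on_def)
  have eq: "subst ?\<sigma> (Node g (L 1) (L 2)) = Node g s t" by simp
  consider "u = Node g s t" | "u \<in> subtrees s" | "u \<in> subtrees t" using Node.prems(1) by auto
  then show ?case
  proof cases
    case 2
    then have "std_is_leading lt R (?\<sigma> 1)" using Node by simp
    then show ?thesis using std_is_leading_context[OF mo _ t0 ad, of R 1] eq by simp
  next
    case 3
    then have "std_is_leading lt R (?\<sigma> 2)" using Node by simp
    then show ?thesis using std_is_leading_context[OF mo _ t0 ad, of R 2] eq by simp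
  qed (use Node.prems in simp)
qed simp

lemma shuffle_tree_subtree: "u \<in> subtrees t \<Longrightarrow> shuffle_tree t \<Longrightarrow> shuffle_tree u"
  by (induction t) auto

text \<open>If \<open>s\<close> occurs in \<open>t\<close>, composing an element with leading monomial \<open>s\<close> with the rest of \<open>t\<close>, first at
  the leaves of the occurrence and then step by step towards the root, gives an element of the ideal
  with leading monomial \<open>t\<close>.\<close>

lemma leading_of_divisible:
  assumes mo: "monomial_order lt" and g: "g \<in> ideal R r" "is_leading lt g s"
    and t: "t \<in> monomials n" and div: "divides s t"
  shows "\<exists>h\<in>ideal R n. is_leading lt h t"
proof -
  have s: "s \<in> monomials r"
    using g ideal_free unfolding free_operad_def is_leading_def by blast
  obtain \<sigma> where \<sigma>: "subst \<sigma> s \<in> subtrees t" "strict_mono_on (leaves s) (\<lambda>i. Min (leaves (\<sigma> i)))"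
    using div unfolding divides_def by blast
  have "shuffle_tree (subst \<sigma> s)" using \<sigma>(1) t shuffle_tree_subtree by (auto simp: monomials_def)
  then have "admissible {1..r} \<sigma>"
    using admissible_of_shuffle_subst[of \<sigma> s] s \<sigma>(2) by (auto simp: monomials_def admissible_def)
  then have "std_is_leading lt R (subst \<sigma> s)" by (rule std_is_leading_subst[OF mo g s])
  then have "std_is_leading lt R t"
    using std_is_leading_supertree[OF mo \<sigma>(1)] t by (auto simp: monomials_def)
  then show ?thesis using t std_eq_self[OF t] by (simp add: std_is_leading_def monomials_def)
qed

section \<open>The reduction argument\<close>

text \<open>Among the elements of the ideal with leading monomial \<open>t\<close>, choose one with the fewest monomials lying
  weakly below some reducible monomial of its support. If \<open>t\<close> is irreducible, the largest reducible
  monomial of the support can be cancelled by an element that has it as leading monomial, which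
  contradicts minimality. So the support is irreducible, and the element is \<open>0\<close>, which has no leading
  monomial.\<close>

lemma leading_reducible:
  assumes mo: "monomial_order lt" and fin: "finite (monomials n)"
    and lead: "\<And>t. t \<in> monomials n \<Longrightarrow> red t \<Longrightarrow> \<exists>h\<in>ideal R n. is_leading lt h t"
    and indep: "\<And>f. f \<in> ideal R n \<Longrightarrow> \<forall>t\<in>Poly_Mapping.keys f. \<not> red t \<Longrightarrow> f = 0"
    and f: "f \<in> ideal R n" and t: "is_leading lt f t"
  shows "red t"
proof (rule ccontr)
  assume nred: "\<not> red t"
  define below where "below f = {q\<in>monomials n. \<exists>r\<in>Poly_Mapping.keys f. red r \<and> (q = r \<or> lt q r)}"
    for f :: "tree \<Rightarrow>\<^sub>0 'a"
  have keys: "Poly_Mapping.keys f \<subseteq> monomials n" if "f \<in> ideal R n" for f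
    using that ideal_free by (auto simp: free_operad_def)
  define P where "P f \<longleftrightarrow> f \<in> ideal R n \<and> is_leading lt f t" for f
  obtain f where f: "f \<in> ideal R n" "is_leading lt f t"
    and min: "\<And>f'. P f' \<Longrightarrow> card (below f) \<le> card (below f')"
    using ex_has_least_nat[of P f "\<lambda>f. card (below f)"] f t unfolding P_def by blast
  let ?A = "{r\<in>Poly_Mapping.keys f. red r}"
  have "f \<noteq> 0" using f(2) by (auto simp: is_leading_def)
  then have "?A \<noteq> {}" using indep[OF f(1)] by blast
  then obtain r where r: "r \<in> ?A" and top: "\<And>q. q \<in> ?A \<Longrightarrow> q \<noteq> r \<Longrightarrow> lt q r"
    using greatest_monomial[OF mo, of ?A n] keys[OF f(1)] by auto
  have rn: "r \<in> monomials n" and tn: "t \<in> monomials n"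
    using r f keys[OF f(1)] by (auto simp: is_leading_def)
  have rt: "lt r t" using r nred f(2) by (auto simp: is_leading_def)
  obtain h where h: "h \<in> ideal R n" "is_leading lt h r" using lead[OF rn] r by blast
  define f' where "f' = f - scale (Poly_Mapping.lookup f r / Poly_Mapping.lookup h r) h"
  have f': "f' \<in> ideal R n" unfolding f'_def by (intro ideal_diff ideal_scale f h)
  have r0: "Poly_Mapping.lookup f' r = 0"
    using h(2) by (simp add: f'_def lookup_minus is_leading_def in_keys_iff)
  have sub: "Poly_Mapping.keys f' \<subseteq> Poly_Mapping.keys f \<union> Poly_Mapping.keys h"
    by (auto simp: f'_def in_keys_iff lookup_minus)
  have hr: "q = r \<or> lt q r" if "q \<in> Poly_Mapping.keys h" for q
    using that h(2) by (auto simp: is_leading_def)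
  \<comment> \<open>All monomials of \<open>h\<close> are at most \<open>r\<close>, hence below \<open>t\<close>; subtracting it leaves \<open>t\<close> in the lead.\<close>
  have "t \<notin> Poly_Mapping.keys h"
    using hr[of t] rt nred r lt_trans[OF mo tn rn tn] lt_irrefl[OF mo tn] by auto
  then have "t \<in> Poly_Mapping.keys f'"
    using f(2) by (simp add: f'_def in_keys_iff lookup_minus is_leading_def)
  moreover have "lt q t" if "q \<in> Poly_Mapping.keys f'" "q \<noteq> t" for q
  proof (cases "q \<in> Poly_Mapping.keys f")
    case True
    then show ?thesis using f(2) that by (auto simp: is_leading_def)
  next
    case False
    then have "q = r \<or> lt q r" using sub hr that by blast
    moreover have "q \<in> monomials n" using keys[OF f'] that by blast
    ultimately show ?thesis using rt lt_trans[OF mo _ rn tn] by blast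
  qed
  ultimately have "P f'" using f' by (simp add: P_def is_leading_def)
  have small: "lt q r" if "q \<in> Poly_Mapping.keys f'" "red q" for q
  proof -
    have "q \<noteq> r" using that r0 by (auto simp: in_keys_iff)
    then show ?thesis using sub hr top that by blast
  qed
  have "r \<in> below f" using r rn by (auto simp: below_def)
  moreover have "r \<notin> below f'"
  proof
    assume "r \<in> below f'"
    then obtain q where q: "q \<in> Poly_Mapping.keys f'" "red q" "r = q \<or> lt r q" by (auto simp: below_def)
    have "lt q r" using small q by blast
    moreover have "q \<in> monomials n" using keys[OF f'] q by blast
    ultimately show False using q(3) lt_trans[OF mo rn _ rn] lt_irrefl[OF mo rn] by blast
  qed
  moreover have "below f' \<subseteq> below f"
  proof
    fix p assume "p \<in> below f'"
    then obtain q where p: "p \<in> monomials n" and q: "q \<in> Poly_Mapping.keys f'" "red q" "p = q \<or> lt p q"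
      by (auto simp: below_def)
    have "q \<in> monomials n" using keys[OF f'] q by blast
    then have "lt p r" using small[OF q(1,2)] q(3) lt_trans[OF mo p _ rn] by blast
    then show "p \<in> below f" using p r by (auto simp: below_def)
  qed
  ultimately have "below f' \<subset> below f" by blast
  moreover have "finite (below f)" using fin by (simp add: below_def)
  ultimately have "card (below f') < card (below f)" by (simp add: psubset_card_mono)
  then show False using min[OF \<open>P f'\<close>] by simp
qed

section \<open>A model: polynomials with the Wronskian bracket\<close>

text \<open>The derivation \<open>t d/dt\<close>. Compared with \<open>d/dt\<close> it has the advantage of preserving each power of \<open>t\<close> up
  to a scalar.\<close>

definition euler :: "'k::field_char_0 poly \<Rightarrow> 'k poly" where
  "euler p = [:0, 1:] * pderiv p"

lemma euler_mult: "euler (p * q) = p * euler q + euler p * q"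
  by (simp add: euler_def pderiv_mult algebra_simps)

lemma euler_add: "euler (p + q) = euler p + euler q"
  and euler_diff: "euler (p - q) = euler p - euler q"
  and euler_zero: "euler 0 = 0"
  and euler_smult: "euler (smult c p) = smult c (euler p)"
  by (simp_all add: euler_def pderiv_add pderiv_diff pderiv_smult algebra_simps)

lemma euler_sum: "euler (\<Sum>x\<in>A. p x) = (\<Sum>x\<in>A. euler (p x))"
  by (induction A rule: infinite_finite_induct) (simp_all add: euler_zero euler_add)

lemma euler_monom: "euler (monom c n) = monom (of_nat n * c) n"
proof -
  have "[:0, 1:] = monom (1::'a) 1" by (simp add: monom_altdef)
  then show ?thesis
    by (cases n) (simp_all add: euler_def pderiv_monom mult_monom One_nat_def)
qed

fun op_poly :: "gen \<Rightarrow> 'k::field_char_0 poly \<Rightarrow> 'k poly \<Rightarrow> 'k poly" where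
  "op_poly Prod p q = p * q"
| "op_poly Bracket p q = p * euler q - q * euler p"

fun eval_tree :: "(nat \<Rightarrow> 'k::field_char_0 poly) \<Rightarrow> tree \<Rightarrow> 'k poly" where
  "eval_tree a (L i) = a i"
| "eval_tree a (Node g s t) = op_poly g (eval_tree a s) (eval_tree a t)"

definition eval_lin :: "(nat \<Rightarrow> 'k::field_char_0 poly) \<Rightarrow> (tree \<Rightarrow>\<^sub>0 'k) \<Rightarrow> 'k poly" where
  "eval_lin a f = (\<Sum>t\<in>Poly_Mapping.keys f. smult (Poly_Mapping.lookup f t) (eval_tree a t))"

lemma eval_lin_superset:
  "finite A \<Longrightarrow> Poly_Mapping.keys f \<subseteq> A \<Longrightarrow> eval_lin a f = (\<Sum>t\<in>A. smult (Poly_Mapping.lookup f t) (eval_tree a t))"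
  unfolding eval_lin_def by (rule sum.mono_neutral_left) (auto simp: in_keys_iff)

lemma eval_lin_zero [simp]: "eval_lin a 0 = 0"
  by (simp add: eval_lin_def)

lemma eval_lin_add [simp]: "eval_lin a (f + g) = eval_lin a f + eval_lin a g"
proof -
  let ?A = "Poly_Mapping.keys f \<union> Poly_Mapping.keys g"
  have "eval_lin a (f + g) = (\<Sum>t\<in>?A. smult (Poly_Mapping.lookup (f + g) t) (eval_tree a t))"
    by (rule eval_lin_superset) (auto simp: Poly_Mapping.keys_add)
  also have "\<dots> = eval_lin a f + eval_lin a g"
    by (simp add: eval_lin_superset[of ?A f] eval_lin_superset[of ?A g] lookup_add smult_add_left sum.distrib)
  finally show ?thesis .
qed

lemma smult_sum: "smult c (\<Sum>x\<in>A. p x) = (\<Sum>x\<in>A. smult c (p x))"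
  by (induction A rule: infinite_finite_induct) (simp_all add: smult_add_right)

lemma eval_lin_scale [simp]: "eval_lin a (scale c f) = smult c (eval_lin a f)"
  using eval_lin_superset[OF finite_keys keys_scale, of a c f]
  by (simp add: eval_lin_def smult_sum)

lemma eval_lin_diff [simp]: "eval_lin a (f - g) = eval_lin a f - eval_lin a g"
  using eval_lin_add[of a f "- g"] eval_lin_scale[of a "- 1" g] by simp

lemma eval_lin_single [simp]: "eval_lin a (c \<odot> t) = smult c (eval_tree a t)"
  by (cases "c = 0") (simp_all add: eval_lin_def)

lemma eval_lin_sum: "eval_lin a (\<Sum>x\<in>A. f x) = (\<Sum>x\<in>A. eval_lin a (f x))"
  by (induction A rule: infinite_finite_induct) simp_all

lemma eval_tree_subst: "eval_tree a (subst \<sigma> t) = eval_tree (\<lambda>i. eval_tree a (\<sigma> i)) t"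
  by (induction t) simp_all

lemma eval_tree_cong: "(\<And>i. i \<in> leaves t \<Longrightarrow> a i = b i) \<Longrightarrow> eval_tree a t = eval_tree b t"
  by (induction t) simp_all

text \<open>Each leaf of a shuffle tree occurs exactly once, and both operations are bilinear.\<close>

lemma eval_tree_linear_in_leaf:
  assumes "shuffle_tree t" "j \<in> leaves t"
  shows "eval_tree (w(j := (\<Sum>x\<in>K. smult (c x) (v x)))) t = (\<Sum>x\<in>K. smult (c x) (eval_tree (w(j := v x)) t))"
  using assms
proof (induction t)
  case (Node g s t)
  have other: "eval_tree (w(j := z)) u = eval_tree w u" if "j \<notin> leaves u" for z u
    using that by (intro eval_tree_cong) auto
  consider "j \<in> leaves s" "j \<notin> leaves t" | "j \<notin> leaves s" "j \<in> leaves t"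
    using Node.prems by auto
  then show ?case
  proof cases
    case 1
    then show ?thesis using Node
      by (cases g) (simp_all add: other sum_distrib_left sum_distrib_right euler_sum euler_smult
        smult_diff_right sum_subtractf del: fun_upd_apply)
  next
    case 2
    then show ?thesis using Node
      by (cases g) (simp_all add: other sum_distrib_left sum_distrib_right euler_sum euler_smult
        smult_diff_right sum_subtractf del: fun_upd_apply)
  qed
qed simp

lemma eval_lin_compose:
  "eval_lin a (compose r I f b) = (\<Sum>m\<in>(\<Pi>\<^sub>E i\<in>{1..r}. Poly_Mapping.keys (b i)).
     smult (\<Prod>i\<in>{1..r}. Poly_Mapping.lookup (b i) (m i))
       (eval_lin (\<lambda>i. eval_tree (\<lambda>j. a (sorted_list_of_set (I i) ! (j - 1))) (m i)) f))"
  unfolding compose_def eval_lin_sum eval_lin_single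
  by (subst sum.swap) (simp add: graft_def eval_tree_subst eval_lin_def smult_sum mult.commute)

text \<open>The elements vanishing under every assignment form an ideal. For an outer composition, fix the
  monomials chosen in the inputs: what remains is an evaluation of \<open>f\<close> at another assignment. For an
  inner composition, linearity in the leaf \<open>j\<close> gathers the terms into the evaluation of \<open>b j\<close>.\<close>

lemma ideal_vanishes:
  assumes "in_ideal R n f" and R: "\<And>a f. f \<in> R \<Longrightarrow> eval_lin a f = 0"
  shows "eval_lin a f = 0"
  using assms(1)
proof (induction arbitrary: a rule: in_ideal.induct)
  case (compose_outer r f n I b)
  then show ?case by (simp add: eval_lin_compose)
next
  case (compose_inner f r n I b j)
  \<comment> \<open>Separate the choice of a monomial in \<open>b j\<close> from the choices in the other inputs.\<close>
  let ?S = "{1..r} - {j}"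
  let ?K = "\<lambda>i. Poly_Mapping.keys (b i)"
  let ?a = "\<lambda>i j. a (sorted_list_of_set (I i) ! (j - 1))"
  have ins: "{1..r} = insert j ?S" using compose_inner by auto
  have fin: "finite (\<Pi>\<^sub>E i\<in>?S. ?K i)" by (intro finite_PiE) auto
  have bj: "eval_lin (?a j) (b j) = 0" using compose_inner by blast
  have "eval_lin a (compose r I (1 \<odot> t) b) = 0" if t: "t \<in> monomials r" for t
  proof -
    let ?g = "\<lambda>m. smult (\<Prod>i\<in>{1..r}. Poly_Mapping.lookup (b i) (m i)) (eval_tree (\<lambda>i. eval_tree (?a i) (m i)) t)"
    have t': "shuffle_tree t" "j \<in> leaves t" using t compose_inner by (auto simp: monomials_def)
    have "eval_lin a (compose r I (1 \<odot> t) b) = (\<Sum>m\<in>(\<Pi>\<^sub>E i\<in>{1..r}. ?K i). ?g m)"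
      by (simp add: eval_lin_compose)
    also have "\<dots> = (\<Sum>(x, m)\<in>?K j \<times> (\<Pi>\<^sub>E i\<in>?S. ?K i). ?g (m(j := x)))"
    proof -
      have "inj_on (\<lambda>(x, m). m(j := x)) (?K j \<times> (\<Pi>\<^sub>E i\<in>?S. ?K i))"
        by (rule inj_combinator) simp
      then show ?thesis
        by (subst (1) ins, subst PiE_insert_eq) (simp add: sum.reindex case_prod_unfold)
    qed
    also have "\<dots> = (\<Sum>m\<in>(\<Pi>\<^sub>E i\<in>?S. ?K i). \<Sum>x\<in>?K j. ?g (m(j := x)))"
      by (subst sum.swap) (simp add: sum.cartesian_product)
    also have "\<dots> = (\<Sum>m\<in>(\<Pi>\<^sub>E i\<in>?S. ?K i). 0)"
    proof (rule sum.cong[OF refl])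
      fix m
      let ?w = "\<lambda>i. eval_tree (?a i) (m i)"
      have "(\<Prod>i\<in>{1..r}. Poly_Mapping.lookup (b i) ((m(j := x)) i)) =
          Poly_Mapping.lookup (b j) x * (\<Prod>i\<in>?S. Poly_Mapping.lookup (b i) (m i))" for x
        by (subst ins, subst prod.insert) (auto intro!: prod.cong)
      moreover have "(\<lambda>i. eval_tree (?a i) ((m(j := x)) i)) = ?w(j := eval_tree (?a j) x)" for x by auto
      ultimately have "(\<Sum>x\<in>?K j. ?g (m(j := x))) = smult (\<Prod>i\<in>?S. Poly_Mapping.lookup (b i) (m i))
          (\<Sum>x\<in>?K j. smult (Poly_Mapping.lookup (b j) x) (eval_tree (?w(j := eval_tree (?a j) x)) t))"
        by (simp add: smult_sum mult.commute del: fun_upd_apply)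
      also have "(\<Sum>x\<in>?K j. smult (Poly_Mapping.lookup (b j) x) (eval_tree (?w(j := eval_tree (?a j) x)) t)) =
          eval_tree (?w(j := eval_lin (?a j) (b j))) t"
        unfolding eval_lin_def by (rule eval_tree_linear_in_leaf[OF t', symmetric])
      also have "\<dots> = 0"
        unfolding bj using eval_tree_linear_in_leaf[OF t', of ?w _ _ "{}"] by simp
      finally show "(\<Sum>x\<in>?K j. ?g (m(j := x))) = 0" by simp
    qed
    finally show ?thesis by simp
  qed
  moreover have "eval_lin a (compose r I f b) =
      (\<Sum>t\<in>Poly_Mapping.keys f. smult (Poly_Mapping.lookup f t) (eval_lin a (compose r I (1 \<odot> t) b)))"
    unfolding eval_lin_compose eval_lin_single unfolding eval_lin_def smult_sum
    by (subst sum.swap) (simp add: mult.commute)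
  ultimately show ?case using compose_inner.hyps(1) by (auto simp: free_operad_def intro!: sum.neutral)
qed (simp_all add: R)

lemma relations_vanish: "f \<in> comGD_relations \<Longrightarrow> eval_lin a f = 0"
  unfolding comGD_relations_def
  by (elim insertE emptyE; hypsubst; simp add: euler_mult euler_diff algebra_simps)

fun exponent_sum :: "(nat \<Rightarrow> nat) \<Rightarrow> tree \<Rightarrow> nat" where
  "exponent_sum e (L i) = e i"
| "exponent_sum e (Node g s t) = exponent_sum e s + exponent_sum e t"

text \<open>The Wronskian bracket of \<open>t^p\<close> and \<open>t^q\<close> is \<open>(q - p) t^(p + q)\<close>; these factors make up the coefficient
  of the value of a tree at powers of \<open>t\<close>.\<close>

fun eval_coeff :: "(nat \<Rightarrow> nat) \<Rightarrow> tree \<Rightarrow> int" where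
  "eval_coeff e (L i) = 1"
| "eval_coeff e (Node g s t) = eval_coeff e s * eval_coeff e t *
     (case g of Prod \<Rightarrow> 1 | Bracket \<Rightarrow> int (exponent_sum e t) - int (exponent_sum e s))"

lemma eval_tree_monom: "eval_tree (\<lambda>i. monom 1 (e i)) t = monom (of_int (eval_coeff e t)) (exponent_sum e t)"
proof (induction t)
  case (Node g s t)
  then show ?case
    by (cases g) (simp_all add: euler_monom mult_monom diff_monom algebra_simps)
qed simp

lemma exponent_sum_monomial: "t \<in> monomials n \<Longrightarrow> exponent_sum e t = (\<Sum>i=1..n. e i)"
proof -
  have "shuffle_tree t \<Longrightarrow> exponent_sum e t = sum e (leaves t)"
    by (induction t) (simp_all add: sum.union_disjoint)
  then show "t \<in> monomials n \<Longrightarrow> exponent_sum e t = (\<Sum>i=1..n. e i)" by (auto simp: monomials_def)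
qed

text \<open>All monomials of arity \<open>n\<close> evaluate to multiples of the same power of \<open>t\<close>, so each choice of
  exponents gives one linear equation for the coefficients.\<close>

lemma ideal_equation:
  fixes f :: "tree \<Rightarrow>\<^sub>0 'k::field_char_0"
  assumes f: "f \<in> ideal comGD_relations n" and keys: "Poly_Mapping.keys f \<subseteq> set N" and N: "distinct N"
  shows "(\<Sum>t\<leftarrow>N. Poly_Mapping.lookup f t * of_int (eval_coeff e t)) = 0"
proof -
  have mon: "Poly_Mapping.keys f \<subseteq> monomials n" using f ideal_free by (auto simp: free_operad_def)
  have "0 = eval_lin (\<lambda>i. monom 1 (e i)) f"
    using f ideal_vanishes[of comGD_relations n f "\<lambda>i. monom 1 (e i)", OF _ relations_vanish] by (simp add: ideal_def)
  also have "\<dots> = (\<Sum>t\<in>Poly_Mapping.keys f. monom (Poly_Mapping.lookup f t * of_int (eval_coeff e t)) (\<Sum>i=1..n. e i))"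
    unfolding eval_lin_def by (rule sum.cong) (use mon exponent_sum_monomial in \<open>auto simp: eval_tree_monom smult_monom\<close>)
  also have "\<dots> = monom (\<Sum>t\<in>Poly_Mapping.keys f. Poly_Mapping.lookup f t * of_int (eval_coeff e t)) (\<Sum>i=1..n. e i)"
    by (simp add: monom_sum)
  finally have "0 = (\<Sum>t\<in>Poly_Mapping.keys f. Poly_Mapping.lookup f t * of_int (eval_coeff e t))"
    by (simp add: monom_eq_0_iff)
  also have "\<dots> = (\<Sum>t\<in>set N. Poly_Mapping.lookup f t * of_int (eval_coeff e t))"
    by (rule sum.mono_neutral_left) (use keys in \<open>auto simp: in_keys_iff\<close>)
  finally show ?thesis using N by (simp add: sum_list_distinct_conv_sum_set)
qed

section \<open>Enumerating irreducible trees\<close>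

fun least :: "tree \<Rightarrow> nat" where
  "least (L i) = i"
| "least (Node g s t) = least s"

lemma least_eq_Min: "shuffle_tree t \<Longrightarrow> least t = Min (leaves t)"
  by (induction t) (simp_all add: Min_Un min_absorb1 less_imp_le del: Min_gr_iff Min_less_iff)

text \<open>The only candidate for the trees grafted onto the leaves of \<open>s\<close> in an occurrence of \<open>s\<close> at the root
  of \<open>u\<close>. If the shapes do not match, the value is arbitrary, and substitution does not give back \<open>u\<close>.\<close>

fun occurrence :: "tree \<Rightarrow> tree \<Rightarrow> nat \<Rightarrow> tree" where
  "occurrence (L i) u = (\<lambda>_. u)"
| "occurrence (Node g a b) (Node h c d) = (\<lambda>i. if i \<in> leaves a then occurrence a c i else occurrence b d i)"
| "occurrence (Node g a b) (L j) = (\<lambda>_. L j)"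

text \<open>An executable criterion for \<open>s\<close> to occur at the root of \<open>u\<close>.\<close>

definition redex :: "tree \<Rightarrow> tree \<Rightarrow> bool" where
  "redex s u \<longleftrightarrow> subst (occurrence s u) s = u \<and>
     (\<forall>i\<in>leaves s. \<forall>j\<in>leaves s. i < j \<longrightarrow> least (occurrence s u i) < least (occurrence s u j))"

lemma redex_divides:
  assumes "redex s u" "u \<in> subtrees t" "shuffle_tree t" "shuffle_tree s"
  shows "divides s t"
proof -
  have u: "subst (occurrence s u) s = u" using assms(1) by (simp add: redex_def)
  have "shuffle_tree u" using assms(2,3) by (rule shuffle_tree_subtree)
  then have "\<forall>i\<in>leaves s. shuffle_tree (occurrence s u i)"
    using admissible_of_shuffle_subst[of "occurrence s u" s] u assms(4) by simp
  then have "strict_mono_on (leaves s) (\<lambda>i. Min (leaves (occurrence s u i)))"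
    using assms(1) unfolding redex_def strict_mono_on_def by (simp flip: least_eq_Min)
  then show ?thesis unfolding divides_def using u assms(2) by metis
qed

fun splits :: "'a list \<Rightarrow> ('a list \<times> 'a list) list" where
  "splits [] = [([], [])]"
| "splits (x # xs) = concat (map (\<lambda>(a, b). [(x # a, b), (a, x # b)]) (splits xs))"

lemma filter_in_splits: "(filter p xs, filter (\<lambda>x. \<not> p x) xs) \<in> set (splits xs)"
proof (induction xs)
  case (Cons x xs)
  then show ?case by (cases "p x") (auto intro!: bexI[OF _ Cons.IH])
qed simp

text \<open>The shuffle trees on the increasing list \<open>x # xs\<close> of labels none of whose internal nodes satisfies
  \<open>P\<close>: the smallest label \<open>x\<close> has to lie in the left subtree. Pruning at every node keeps the
  enumeration of irreducible trees small. The number \<open>k\<close> bounds the depth of the recursion.\<close>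

fun trees_avoiding :: "(tree \<Rightarrow> bool) \<Rightarrow> nat \<Rightarrow> nat list \<Rightarrow> tree list" where
  "trees_avoiding P 0 xs = []"
| "trees_avoiding P (Suc k) [] = []"
| "trees_avoiding P (Suc k) (x # xs) = (if xs = [] then [L x] else
     concat (map (\<lambda>(a, b). if b = [] then [] else
       concat (map (\<lambda>s. concat (map (\<lambda>t.
         filter (\<lambda>u. \<not> P u) [X s t, Z s t])
         (trees_avoiding P k b))) (trees_avoiding P k (x # a)))) (splits xs)))"

lemma trees_avoiding_complete:
  "shuffle_tree t \<Longrightarrow> leaves t = set xs \<Longrightarrow> sorted_wrt (<) xs \<Longrightarrow> length xs \<le> k \<Longrightarrow>
    (\<And>u. u \<in> subtrees t \<Longrightarrow> \<not> P u) \<Longrightarrow> t \<in> set (trees_avoiding P k xs)"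
proof (induction t arbitrary: xs k)
  case (L i)
  obtain x ys where xs: "xs = x # ys" using L.prems(2) by (cases xs) auto
  have "ys = []" using L.prems(2,3) xs by (cases ys) auto
  then show ?case using L.prems xs by (cases k) auto
next
  case (Node g s t)
  have sh: "shuffle_tree s" "shuffle_tree t" "leaves s \<inter> leaves t = {}" "Min (leaves s) < Min (leaves t)"
    using Node.prems(1) by auto
  obtain x ys where xs: "xs = x # ys" using Node.prems(2) by (cases xs) auto
  have un: "leaves s \<union> leaves t = insert x (set ys)" using Node.prems(2) xs by simp
  have x: "\<forall>y\<in>set ys. x < y" "sorted_wrt (<) ys" using Node.prems(3) xs by auto
  have "x \<notin> leaves t"
  proof
    assume "x \<in> leaves t"
    then have "Min (leaves s) < x" using sh(4) by (meson Min_le finite_leaves less_le_trans)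
    moreover have "Min (leaves s) \<in> insert x (set ys)" using un by (metis Min_in UnI1 finite_leaves leaves_nonempty)
    ultimately show False using x(1) by auto
  qed
  then have xs': "x \<in> leaves s" using un by blast
  let ?a = "filter (\<lambda>i. i \<in> leaves s) ys" and ?b = "filter (\<lambda>i. i \<notin> leaves s) ys"
  have la: "leaves s = set (x # ?a)" using un xs' by auto
  have lb: "leaves t = set ?b" using un xs' sh(3) \<open>x \<notin> leaves t\<close> by auto
  have bne: "?b \<noteq> []" using lb leaves_nonempty[of t] by (metis list.set(1))
  have len: "length ?a + length ?b = length ys" by (rule sum_length_filter_compl)
  obtain k' where k: "k = Suc k'" using Node.prems(4) xs by (cases k) auto
  have "length ?b > 0" using bne by simp
  then have lens: "length (x # ?a) \<le> k'" "length ?b \<le> k'"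
    using len Node.prems(4) xs k by (simp_all del: length_greater_0_conv)
  have s: "s \<in> set (trees_avoiding P k' (x # ?a))"
    by (rule Node.IH(1)[OF sh(1) la _ lens(1)]) (use x Node.prems(5) in \<open>auto simp: sorted_wrt_filter\<close>)
  have t: "t \<in> set (trees_avoiding P k' ?b)"
    by (rule Node.IH(2)[OF sh(2) lb _ lens(2)]) (use x Node.prems(5) in \<open>auto simp: sorted_wrt_filter\<close>)
  have P: "\<not> P (Node g s t)" using Node.prems(5) by simp
  have ys: "ys \<noteq> []" using bne by auto
  have "Node g s t \<in> set (concat (map (\<lambda>s. concat (map (\<lambda>t.
      filter (\<lambda>u. \<not> P u) [X s t, Z s t]) (trees_avoiding P k' ?b))) (trees_avoiding P k' (x # ?a))))"
    (is "_ \<in> ?N")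
    using s t P by (cases g) auto
  moreover have "?N \<subseteq> set (trees_avoiding P k xs)"
    unfolding k xs trees_avoiding.simps(3) if_not_P[OF ys] set_concat set_map
    using bne by (intro order_trans[OF _ UN_upper[OF imageI[OF filter_in_splits[of "\<lambda>i. i \<in> leaves s" ys]]]]) simp
  ultimately show ?case by blast
qed

lemma monomials_avoiding:
  assumes "t \<in> monomials n" "\<And>u. u \<in> subtrees t \<Longrightarrow> \<not> P u"
  shows "t \<in> set (trees_avoiding P n [1..<Suc n])"
  using assms by (intro trees_avoiding_complete) (auto simp: monomials_def simp del: upt_Suc)

text \<open>With nothing to avoid, the enumeration lists all monomials.\<close>

lemma finite_monomials: "finite (monomials n)"
  using monomials_avoiding[of _ n "\<lambda>_. False"]
  by (auto intro: finite_subset[OF _ finite_set[of "trees_avoiding (\<lambda>_. False) n [1..<Suc n]"]])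

definition left_sides :: "tree list" where
  "left_sides = [
     X (X (L 1) (L 3)) (L 2), X (X (L 1) (L 2)) (L 3), Z (X (L 1) (L 2)) (L 3),
     X (Z (L 1) (L 2)) (L 3), Z (Z (L 1) (L 2)) (L 3), Z (X (L 1) (L 3)) (L 2),
     X (Z (L 1) (L 4)) (Z (L 2) (L 3)), X (Z (L 1) (L 3)) (X (L 2) (L 4)),
     X (Z (L 1) (L 4)) (X (L 2) (L 3)), X (Z (L 1) (X (L 3) (L 4))) (L 2),
     Z (Z (L 1) (L 4)) (X (L 2) (L 3)), Z (Z (L 1) (L 3)) (X (L 2) (L 4))]"

lemma left_sides: "fst ` comGD_rules = set left_sides"
  by (simp add: comGD_rules_def left_sides_def)

definition normal_trees :: "nat \<Rightarrow> tree list" where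
  "normal_trees n = trees_avoiding (\<lambda>u. \<exists>s\<in>set left_sides. redex s u) n [1..<Suc n]"

lemma normal_trees_0: "normal_trees 0 = []"
  by (simp add: normal_trees_def)

lemma normal_trees_1: "normal_trees 1 = [L 1]"
  by code_simp

lemma normal_trees_2: "set (normal_trees 2) = {X (L 1) (L 2), Z (L 1) (L 2)}"
  by code_simp

lemma normal_trees_3: "set (normal_trees 3) = {
   X (L 1) (X (L 2) (L 3)), Z (L 1) (X (L 2) (L 3)), X (L 1) (Z (L 2) (L 3)),
   X (Z (L 1) (L 3)) (L 2), Z (L 1) (Z (L 2) (L 3)), Z (Z (L 1) (L 3)) (L 2)}"
  by code_simp

lemma normal_trees_4: "set (normal_trees 4) = {
   X (L 1) (X (L 2) (X (L 3) (L 4))), Z (L 1) (X (L 2) (X (L 3) (L 4))), X (L 1) (Z (L 2) (X (L 3) (L 4))),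
   X (L 1) (X (L 2) (Z (L 3) (L 4))), X (L 1) (X (Z (L 2) (L 4)) (L 3)), Z (L 1) (Z (L 2) (X (L 3) (L 4))),
   Z (L 1) (X (L 2) (Z (L 3) (L 4))), X (L 1) (Z (L 2) (Z (L 3) (L 4))), Z (L 1) (X (Z (L 2) (L 4)) (L 3)),
   X (L 1) (Z (Z (L 2) (L 4)) (L 3)), X (Z (L 1) (L 3)) (Z (L 2) (L 4)), Z (Z (L 1) (X (L 3) (L 4))) (L 2),
   X (Z (L 1) (Z (L 3) (L 4))) (L 2), X (Z (Z (L 1) (L 4)) (L 3)) (L 2), Z (L 1) (Z (L 2) (Z (L 3) (L 4))),
   Z (L 1) (Z (Z (L 2) (L 4)) (L 3)), Z (Z (L 1) (L 3)) (Z (L 2) (L 4)), Z (Z (L 1) (L 4)) (Z (L 2) (L 3)),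
   Z (Z (L 1) (Z (L 3) (L 4))) (L 2), Z (Z (Z (L 1) (L 4)) (L 3)) (L 2)}"
  by code_simp

section \<open>Independence of the irreducible monomials\<close>

abbreviation exponents :: "nat \<Rightarrow> nat \<Rightarrow> nat \<Rightarrow> nat \<Rightarrow> nat \<Rightarrow> nat" where
  "exponents a b c d \<equiv> (\<lambda>_. 0)(1 := a, 2 := b, 3 := c, 4 := d)"

lemma poly_mapping_zero_on:
  "Poly_Mapping.keys f \<subseteq> A \<Longrightarrow> (\<And>t. t \<in> A \<Longrightarrow> Poly_Mapping.lookup f t = 0) \<Longrightarrow> f = 0"
  by (rule poly_mapping_eqI) (auto simp: in_keys_iff)

lemma normal_independent_2:
  fixes f :: "tree \<Rightarrow>\<^sub>0 'k::field_char_0"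
  assumes "f \<in> ideal comGD_relations 2" "Poly_Mapping.keys f \<subseteq> set (normal_trees 2)"
  shows "f = 0"
proof (rule poly_mapping_zero_on[OF assms(2)])
  let ?c = "Poly_Mapping.lookup f"
  let ?N = "[X (L 1) (L 2), Z (L 1) (L 2)]"
  have eq: "(\<Sum>t\<leftarrow>?N. ?c t * of_int (eval_coeff (exponents a b c d) t)) = 0" for a b c d
    by (rule ideal_equation[OF assms(1)]) (use assms(2) in \<open>auto simp: normal_trees_2\<close>)
  have z1: "?c (X (L 1) (L 2)) = 0"
    using eq[of 0 0 0 0] by simp
  note z = z1
  have z2: "?c (Z (L 1) (L 2)) = 0"
    using eq[of 0 1 0 0] by (simp add: z)
  note z = z z2
  show "?c t = 0" if "t \<in> set (normal_trees 2)" for t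
    using that z by (auto simp: normal_trees_2)
qed

lemma normal_independent_3:
  fixes f :: "tree \<Rightarrow>\<^sub>0 'k::field_char_0"
  assumes "f \<in> ideal comGD_relations 3" "Poly_Mapping.keys f \<subseteq> set (normal_trees 3)"
  shows "f = 0"
proof (rule poly_mapping_zero_on[OF assms(2)])
  let ?c = "Poly_Mapping.lookup f"
  let ?N = "[X (L 1) (X (L 2) (L 3)), Z (L 1) (X (L 2) (L 3)), X (L 1) (Z (L 2) (L 3)),
      X (Z (L 1) (L 3)) (L 2), Z (L 1) (Z (L 2) (L 3)), Z (Z (L 1) (L 3)) (L 2)]"
  have eq: "(\<Sum>t\<leftarrow>?N. ?c t * of_int (eval_coeff (exponents a b c d) t)) = 0" for a b c d
    by (rule ideal_equation[OF assms(1)]) (use assms(2) in \<open>auto simp: normal_trees_3\<close>)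
  have z1: "?c (X (L 1) (X (L 2) (L 3))) = 0"
    using eq[of 0 0 0 0] by simp
  note z = z1
  have z2: "?c (X (L 1) (Z (L 2) (L 3))) = 0"
    using eq[of 1 0 1 0] by (simp add: z)
  note z = z z2
  have z3: "?c (X (Z (L 1) (L 3)) (L 2)) = 0"
    using eq[of 1 1 0 0] by (simp add: z)
  note z = z z3
  have z4: "?c (Z (L 1) (X (L 2) (L 3))) = 0"
    using eq[of 0 1 1 0] by (simp add: z)
  note z = z z4
  have z5: "?c (Z (L 1) (Z (L 2) (L 3))) = 0"
    using eq[of 0 1 0 0] by (simp add: z)
  note z = z z5
  have z6: "?c (Z (Z (L 1) (L 3)) (L 2)) = 0"
    using eq[of 0 0 1 0] by (simp add: z)
  note z = z z6
  show "?c t = 0" if "t \<in> set (normal_trees 3)" for t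
    using that z by (auto simp: normal_trees_3)
qed

text \<open>Each step evaluates at exponents for which the monomials that are still open mostly have coefficient
  \<open>0\<close>. The value of a tree with \<open>k\<close> brackets is homogeneous of degree \<open>k\<close> in the exponents, so pairing an
  exponent vector with its double separates the parts with different numbers of brackets.\<close>

lemma normal_independent_4:
  fixes f :: "tree \<Rightarrow>\<^sub>0 'k::field_char_0"
  assumes "f \<in> ideal comGD_relations 4" "Poly_Mapping.keys f \<subseteq> set (normal_trees 4)"
  shows "f = 0"
proof (rule poly_mapping_zero_on[OF assms(2)])
  let ?c = "Poly_Mapping.lookup f"
  let ?N = "[X (L 1) (X (L 2) (X (L 3) (L 4))), Z (L 1) (X (L 2) (X (L 3) (L 4))), X (L 1) (Z (L 2) (X (L 3) (L 4))),
      X (L 1) (X (L 2) (Z (L 3) (L 4))), X (L 1) (X (Z (L 2) (L 4)) (L 3)), Z (L 1) (Z (L 2) (X (L 3) (L 4))),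
      Z (L 1) (X (L 2) (Z (L 3) (L 4))), X (L 1) (Z (L 2) (Z (L 3) (L 4))), Z (L 1) (X (Z (L 2) (L 4)) (L 3)),
      X (L 1) (Z (Z (L 2) (L 4)) (L 3)), X (Z (L 1) (L 3)) (Z (L 2) (L 4)), Z (Z (L 1) (X (L 3) (L 4))) (L 2),
      X (Z (L 1) (Z (L 3) (L 4))) (L 2), X (Z (Z (L 1) (L 4)) (L 3)) (L 2), Z (L 1) (Z (L 2) (Z (L 3) (L 4))),
      Z (L 1) (Z (Z (L 2) (L 4)) (L 3)), Z (Z (L 1) (L 3)) (Z (L 2) (L 4)), Z (Z (L 1) (L 4)) (Z (L 2) (L 3)),
      Z (Z (L 1) (Z (L 3) (L 4))) (L 2), Z (Z (Z (L 1) (L 4)) (L 3)) (L 2)]"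
  have eq: "(\<Sum>t\<leftarrow>?N. ?c t * of_int (eval_coeff (exponents a b c d) t)) = 0" for a b c d
    by (rule ideal_equation[OF assms(1)]) (use assms(2) in \<open>auto simp: normal_trees_4\<close>)
  have z1: "?c (X (L 1) (X (L 2) (X (L 3) (L 4)))) = 0"
    using eq[of 0 0 0 0] by simp
  note z = z1
  have z2: "?c (X (L 1) (Z (L 2) (Z (L 3) (L 4)))) = 0"
    using eq[of 1 0 1 0] eq[of 2 0 2 0] by (simp_all add: z, algebra)
  note z = z z2
  have z3: "?c (Z (L 1) (X (L 2) (Z (L 3) (L 4)))) = 0"
    using eq[of 1 1 0 1] eq[of 2 2 0 2] by (simp_all add: z, algebra)
  note z = z z3
  have z4: "?c (Z (L 1) (X (Z (L 2) (L 4)) (L 3))) = 0"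
    using eq[of 1 1 1 0] eq[of 2 2 2 0] by (simp_all add: z, algebra)
  note z = z z4
  have z5: "?c (Z (L 1) (X (L 2) (X (L 3) (L 4)))) = 0" "?c (X (L 1) (Z (L 2) (X (L 3) (L 4)))) = 0" "?c (Z (L 1) (Z (L 2) (X (L 3) (L 4)))) = 0" "?c (Z (Z (L 1) (X (L 3) (L 4))) (L 2)) = 0"
    using eq[of 0 1 1 1] eq[of 1 1 1 1] eq[of 0 2 2 2] eq[of 2 2 2 2] by (simp_all add: z, algebra+)
  note z = z z5
  have z6: "?c (X (L 1) (X (L 2) (Z (L 3) (L 4)))) = 0"
    using eq[of 1 0 1 0] by (simp add: z)
  note z = z z6
  have z7: "?c (X (L 1) (X (Z (L 2) (L 4)) (L 3))) = 0"
    using eq[of 1 0 1 1] by (simp add: z)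
  note z = z z7
  have z8: "?c (X (Z (L 1) (L 3)) (Z (L 2) (L 4))) = 0"
    using eq[of 0 0 1 1] by (simp add: z)
  note z = z z8
  have z9: "?c (X (Z (L 1) (Z (L 3) (L 4))) (L 2)) = 0"
    using eq[of 0 1 1 0] by (simp add: z)
  note z = z z9
  have z10: "?c (X (Z (Z (L 1) (L 4)) (L 3)) (L 2)) = 0"
    using eq[of 0 1 0 1] by (simp add: z)
  note z = z z10
  have z11: "?c (Z (Z (Z (L 1) (L 4)) (L 3)) (L 2)) = 0"
    using eq[of 1 0 0 0] by (simp add: z)
  note z = z z11
  have z12: "?c (X (L 1) (Z (Z (L 2) (L 4)) (L 3))) = 0"
    using eq[of 1 0 0 1] by (simp add: z)
  note z = z z12
  have z13: "?c (Z (L 1) (Z (Z (L 2) (L 4)) (L 3))) = 0"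
    using eq[of 0 1 0 0] by (simp add: z)
  note z = z z13
  have e1: "2 * ?c (Z (Z (L 1) (L 3)) (Z (L 2) (L 4))) + 2 * ?c (Z (Z (L 1) (L 4)) (Z (L 2) (L 3))) = 0"
    using eq[of 1 2 0 0] by (simp add: z algebra_simps)
  have e2: "(-4) * ?c (Z (Z (L 1) (L 3)) (Z (L 2) (L 4))) + (-8) * ?c (Z (Z (L 1) (L 4)) (Z (L 2) (L 3))) = 0"
    using eq[of 0 3 1 2] by (simp add: z algebra_simps)
  have z14: "?c (Z (Z (L 1) (L 3)) (Z (L 2) (L 4))) = 0" "?c (Z (Z (L 1) (L 4)) (Z (L 2) (L 3))) = 0"
    using e1 e2 by algebra+
  note z = z z14
  have z15: "?c (Z (L 1) (Z (L 2) (Z (L 3) (L 4)))) = 0"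
    using eq[of 1 2 0 1] by (simp add: z)
  note z = z z15
  have z16: "?c (Z (Z (L 1) (Z (L 3) (L 4))) (L 2)) = 0"
    using eq[of 0 0 0 1] by (simp add: z)
  note z = z z16
  show "?c t = 0" if "t \<in> set (normal_trees 4)" for t
    using that z by (auto simp: normal_trees_4)
qed

section \<open>The rules lie in the ideal\<close>

definition assoc_132 :: "tree \<Rightarrow>\<^sub>0 'k::field_char_0" where
  "assoc_132 = rule_elem (X (X (L 1) (L 3)) (L 2),
     1 \<odot> X (L 1) (X (L 2) (L 3)))"

definition assoc_123 :: "tree \<Rightarrow>\<^sub>0 'k::field_char_0" where
  "assoc_123 = rule_elem (X (X (L 1) (L 2)) (L 3),
     1 \<odot> X (L 1) (X (L 2) (L 3)))"

definition bracket_prod_123 :: "tree \<Rightarrow>\<^sub>0 'k::field_char_0" where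
  "bracket_prod_123 = rule_elem (Z (X (L 1) (L 2)) (L 3),
     2 \<odot> X (Z (L 1) (L 3)) (L 2) - 1 \<odot> Z (L 1) (X (L 2) (L 3)))"

definition prod_bracket_123 :: "tree \<Rightarrow>\<^sub>0 'k::field_char_0" where
  "prod_bracket_123 = rule_elem (X (Z (L 1) (L 2)) (L 3),
     1 \<odot> X (Z (L 1) (L 3)) (L 2) - 1 \<odot> X (L 1) (Z (L 2) (L 3)))"

definition jacobi_123 :: "tree \<Rightarrow>\<^sub>0 'k::field_char_0" where
  "jacobi_123 = rule_elem (Z (Z (L 1) (L 2)) (L 3),
     1 \<odot> Z (Z (L 1) (L 3)) (L 2) + 1 \<odot> Z (L 1) (Z (L 2) (L 3)))"

definition bracket_prod_132 :: "tree \<Rightarrow>\<^sub>0 'k::field_char_0" where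
  "bracket_prod_132 = rule_elem (Z (X (L 1) (L 3)) (L 2),
     2 \<odot> X (Z (L 1) (L 3)) (L 2) - 1 \<odot> Z (L 1) (X (L 2) (L 3)) - 2 \<odot> X (L 1) (Z (L 2) (L 3)))"

lemmas arity3_defs = assoc_132_def assoc_123_def bracket_prod_123_def prod_bracket_123_def jacobi_123_def bracket_prod_132_def rule_elem_def

lemma free_operad_single: "t \<in> monomials n \<Longrightarrow> c \<odot> t \<in> free_operad n"
  by (simp add: free_operad_def)

lemma free_operad_add: "f \<in> free_operad n \<Longrightarrow> g \<in> free_operad n \<Longrightarrow> f + g \<in> free_operad n"
  using Poly_Mapping.keys_add[of f g] by (auto simp: free_operad_def)

lemma free_operad_diff: "f \<in> free_operad n \<Longrightarrow> g \<in> free_operad n \<Longrightarrow> f - g \<in> free_operad n"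
  using keys_diff[of f g] by (auto simp: free_operad_def)

text \<open>A generator lies in the ideal only in an arity in which it is an element of the free operad.\<close>

lemma relations_free: "comGD_relations \<subseteq> free_operad 3"
proof -
  have "{1..3::nat} = {1, 2, 3}" by auto
  then show ?thesis
    unfolding comGD_relations_def
    by (auto intro!: free_operad_single free_operad_add free_operad_diff simp: monomials_def)
qed

lemma relations_ideal: "f \<in> comGD_relations \<Longrightarrow> f \<in> ideal comGD_relations 3"
  using relations_free by (auto simp: ideal_def intro: in_ideal.generator)

text \<open>The Kronecker delta as an opaque constant: it keeps a comparison of coefficients from splitting into
  cases, so that an identity in the free operad becomes a linear identity between its values.\<close>

definition mono_coeff :: "tree \<Rightarrow> tree \<Rightarrow> 'k::zero_neq_one" where
  "mono_coeff t s = (1 when t = s)"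

lemma lookup_lterm: "Poly_Mapping.lookup (c \<odot> t) s = c * (mono_coeff t s :: 'k::field)"
  by (simp add: mono_coeff_def lookup_single when_def)

lemmas coefficients = lookup_add lookup_minus lookup_uminus lookup_lterm algebra_simps

lemma arity3_ideal:
  defines "I \<equiv> ideal (comGD_relations :: (tree \<Rightarrow>\<^sub>0 'k::field_char_0) set) 3"
  shows "assoc_132 \<in> I" "assoc_123 \<in> I" "bracket_prod_123 \<in> I"
    "prod_bracket_123 \<in> I" "jacobi_123 \<in> I" "bracket_prod_132 \<in> I"
  unfolding I_def
proof -
  let ?I = "ideal (comGD_relations :: (tree \<Rightarrow>\<^sub>0 'k) set) 3"
  define r4 :: "tree \<Rightarrow>\<^sub>0 'k" where "r4 = 1 \<odot> Z (L 1) (X (L 2) (L 3))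
     + 1 \<odot> Z (X (L 1) (L 2)) (L 3) - 1 \<odot> X (Z (L 1) (L 2)) (L 3)
     - 1 \<odot> X (L 1) (Z (L 2) (L 3)) - 1 \<odot> X (Z (L 1) (L 3)) (L 2)"
  define r5 :: "tree \<Rightarrow>\<^sub>0 'k" where "r5 = - 1 \<odot> Z (X (L 1) (L 3)) (L 2)
     + 1 \<odot> Z (X (L 1) (L 2)) (L 3) + 1 \<odot> X (Z (L 1) (L 2)) (L 3)
     - 1 \<odot> X (Z (L 1) (L 3)) (L 2) - 1 \<odot> X (L 1) (Z (L 2) (L 3))"
  define r6 :: "tree \<Rightarrow>\<^sub>0 'k" where "r6 = - 1 \<odot> X (Z (L 1) (L 2)) (L 3)
     + 1 \<odot> Z (L 1) (X (L 2) (L 3)) + 1 \<odot> Z (X (L 1) (L 3)) (L 2)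
     - 1 \<odot> X (Z (L 1) (L 3)) (L 2) + 1 \<odot> X (L 1) (Z (L 2) (L 3))"
  have r: "r4 \<in> ?I" "r5 \<in> ?I" "r6 \<in> ?I"
    by (rule relations_ideal, simp add: comGD_relations_def r4_def r5_def r6_def)+
  show "assoc_132 \<in> ?I" "assoc_123 \<in> ?I"
    by (rule relations_ideal, simp add: comGD_relations_def arity3_defs)+
  have "jacobi_123 = 1 \<odot> Z (Z (L 1) (L 2)) (L 3) - 1 \<odot> Z (L 1) (Z (L 2) (L 3)) - 1 \<odot> Z (Z (L 1) (L 3)) (L 2)"
    by (simp add: arity3_defs algebra_simps)
  then show "jacobi_123 \<in> ?I"
    by (metis (no_types, lifting) relations_ideal comGD_relations_def insertCI)
  \<comment> \<open>Gaussian elimination: \<open>r5 + r6\<close> and \<open>r4\<close> differ by the rule for a product with a bracket, which then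
    removes \<open>X (Z (L 1) (L 2)) (L 3)\<close> from \<open>r6\<close>.\<close>
  have p: "prod_bracket_123 = r5 + r6 - r4" and b: "bracket_prod_123 = r5 + r6"
    and b': "bracket_prod_132 = r6 + (r5 + r6 - r4)"
    by (rule poly_mapping_eqI, simp add: arity3_defs r4_def r5_def r6_def coefficients)+
  show "prod_bracket_123 \<in> ?I" unfolding p by (intro ideal_add ideal_diff r)
  show "bracket_prod_123 \<in> ?I" unfolding b by (intro ideal_add r)
  show "bracket_prod_132 \<in> ?I" unfolding b' by (intro ideal_add ideal_diff r)
qed

abbreviation three :: "'a \<Rightarrow> 'a \<Rightarrow> 'a \<Rightarrow> nat \<Rightarrow> 'a" where
  "three a b c \<equiv> (\<lambda>i. if i = 1 then a else if i = 2 then b else c)"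

text \<open>The composite \<open>f(a, b, c)\<close>; the leaf labels of \<open>a\<close>, \<open>b\<close>, \<open>c\<close> are those of the result.\<close>

definition plug :: "(tree \<Rightarrow>\<^sub>0 'k::field) \<Rightarrow> tree \<Rightarrow> tree \<Rightarrow> tree \<Rightarrow> (tree \<Rightarrow>\<^sub>0 'k)" where
  "plug f a b c = lin (subst (three a b c)) f"

text \<open>The elements \<open>g(f(a, b, c), d)\<close> and, below, \<open>g(1, f(2, 3, 4))\<close>, obtained by applying one more operation
  to \<open>f\<close>.\<close>

definition under_left :: "gen \<Rightarrow> (tree \<Rightarrow>\<^sub>0 'k::field) \<Rightarrow> nat \<Rightarrow> nat \<Rightarrow> nat \<Rightarrow> nat \<Rightarrow> (tree \<Rightarrow>\<^sub>0 'k)" where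
  "under_left g f a b c d = lin (\<lambda>u. Node g (subst (\<lambda>i. L (three a b c i)) u) (L d)) f"

definition under_right :: "gen \<Rightarrow> (tree \<Rightarrow>\<^sub>0 'k::field) \<Rightarrow> (tree \<Rightarrow>\<^sub>0 'k)" where
  "under_right g f = lin (\<lambda>u. Node g (L 1) (subst (\<lambda>i. L (three 2 3 4 i)) u)) f"

lemmas compose_coefficients = plug_def under_left_def under_right_def coefficients

lemma plug_ideal:
  assumes f: "f \<in> ideal R 3"
    and sh: "shuffle_tree a" "shuffle_tree b" "shuffle_tree c"
    and dis: "leaves a \<inter> leaves b = {}" "leaves a \<inter> leaves c = {}" "leaves b \<inter> leaves c = {}"
    and Min: "Min (leaves a) < Min (leaves b)" "Min (leaves b) < Min (leaves c)"
    and un: "leaves a \<union> leaves b \<union> leaves c = {1, 2, 3, 4}"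
  shows "plug f a b c \<in> ideal R 4"
  unfolding plug_def
proof (rule ideal_outer[OF f])
  have three: "{1..3} = {1, 2, 3::nat}" "{1..4} = {1, 2, 3, 4::nat}" by auto
  have "Min (leaves a) < Min (leaves c)" using Min by (rule less_trans)
  then show "inflation 3 4 (three a b c)"
    unfolding inflation_def admissible_def disjoint_family_on_def strict_mono_on_def three
    using sh dis Min un by (auto simp: Int_commute Un_assoc simp del: Min_gr_iff Min_less_iff)
qed

lemma inflation_two:
  assumes "shuffle_tree (Node g u v)" "leaves u \<union> leaves v = {1, 2, 3, 4}"
  shows "inflation 2 4 (\<lambda>i. if i = 1 then u else v)"
proof -
  have "{1..2} = {1, 2::nat}" "{1..4} = {1, 2, 3, 4::nat}" by auto
  then show ?thesis
    using assms unfolding inflation_def admissible_def disjoint_family_on_def strict_mono_on_def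
    by (auto simp: Int_commute simp del: Min_gr_iff Min_less_iff)
qed

lemma under_left_ideal:
  assumes f: "f \<in> ideal R 3" and ord: "a < b" "b < c" "a < d" and un: "{a, b, c, d} = {1, 2, 3, 4}"
    and dist: "d \<noteq> b" "d \<noteq> c"
  shows "under_left g f a b c d \<in> ideal R 4"
proof -
  let ?\<sigma> = "\<lambda>i::nat. if i = 1 then X (X (L a) (L b)) (L c) else L d"
  have three: "{1..3} = {1, 2, 3::nat}" "{1..2} = {1, 2::nat}" by auto
  have inf: "inflation 2 4 ?\<sigma>"
    by (rule inflation_two[of g]) (use ord dist un in auto)
  have "lin (\<lambda>u. subst (?\<sigma>(1 := subst (\<lambda>i. L (three a b c i)) u)) (Node g (L 1) (L 2))) f \<in> ideal R 4"
    by (rule ideal_inner[OF f inf]) (use ord in \<open>auto simp: monomials_def three strict_mono_on_def\<close>)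
  then show ?thesis by (simp add: under_left_def)
qed

lemma under_right_ideal:
  assumes f: "f \<in> ideal R 3"
  shows "under_right g f \<in> ideal R 4"
proof -
  let ?\<sigma> = "\<lambda>i::nat. if i = 1 then L 1 else X (X (L 2) (L 3)) (L 4)"
  have three: "{1..3} = {1, 2, 3::nat}" "{1..2} = {1, 2::nat}" by auto
  have inf: "inflation 2 4 ?\<sigma>"
    by (rule inflation_two[of g]) auto
  have "lin (\<lambda>u. subst (?\<sigma>(2 := subst (\<lambda>i. L (three 2 3 4 i)) u)) (Node g (L 1) (L 2))) f \<in> ideal R 4"
    by (rule ideal_inner[OF f inf]) (auto simp: monomials_def three strict_mono_on_def)
  then show ?thesis by (simp add: under_right_def)
qed

lemma ideal_unscale: "scale c f \<in> ideal R n \<Longrightarrow> c \<noteq> 0 \<Longrightarrow> f \<in> ideal R n"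
proof -
  assume "scale c f \<in> ideal R n" "c \<noteq> 0"
  moreover have "scale (1 / c) (scale c f) = f" if "c \<noteq> 0"
    using that by (intro poly_mapping_eqI) simp
  ultimately show ?thesis by (metis ideal_scale)
qed

definition prod_bracket_bracket_1423 :: "tree \<Rightarrow>\<^sub>0 'k::field_char_0" where
  "prod_bracket_bracket_1423 = rule_elem (X (Z (L 1) (L 4)) (Z (L 2) (L 3)),
     1 \<odot> X (Z (L 1) (L 3)) (Z (L 2) (L 4)) - 1 \<odot> X (Z (L 1) (Z (L 3) (L 4))) (L 2) + 1 \<odot> X (L 1) (Z (L 2) (Z (L 3) (L 4))))"

definition prod_bracket_prod_1324 :: "tree \<Rightarrow>\<^sub>0 'k::field_char_0" where
  "prod_bracket_prod_1324 = rule_elem (X (Z (L 1) (L 3)) (X (L 2) (L 4)),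
     1 \<odot> Z (L 1) (X (L 2) (X (L 3) (L 4))) + 3 \<odot> X (L 1) (X (Z (L 2) (L 4)) (L 3)) - 2 \<odot> X (L 1) (Z (L 2) (X (L 3) (L 4)))
      - 2 \<odot> X (L 1) (X (L 2) (Z (L 3) (L 4))))"

definition prod_bracket_prod_1423 :: "tree \<Rightarrow>\<^sub>0 'k::field_char_0" where
  "prod_bracket_prod_1423 = rule_elem (X (Z (L 1) (L 4)) (X (L 2) (L 3)),
     1 \<odot> Z (L 1) (X (L 2) (X (L 3) (L 4))) + 3 \<odot> X (L 1) (X (Z (L 2) (L 4)) (L 3)) - 2 \<odot> X (L 1) (Z (L 2) (X (L 3) (L 4)))
      - 1 \<odot> X (L 1) (X (L 2) (Z (L 3) (L 4))))"

definition prod_bracket_prod_1342 :: "tree \<Rightarrow>\<^sub>0 'k::field_char_0" where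
  "prod_bracket_prod_1342 = rule_elem (X (Z (L 1) (X (L 3) (L 4))) (L 2),
     1 \<odot> Z (L 1) (X (L 2) (X (L 3) (L 4))) + 2 \<odot> X (L 1) (X (Z (L 2) (L 4)) (L 3)) - 1 \<odot> X (L 1) (Z (L 2) (X (L 3) (L 4)))
      - 1 \<odot> X (L 1) (X (L 2) (Z (L 3) (L 4))))"

definition bracket_bracket_prod_1423 :: "tree \<Rightarrow>\<^sub>0 'k::field_char_0" where
  "bracket_bracket_prod_1423 = rule_elem (Z (Z (L 1) (L 4)) (X (L 2) (L 3)),
     1 \<odot> Z (Z (L 1) (X (L 3) (L 4))) (L 2) - 2 \<odot> X (Z (L 1) (L 3)) (Z (L 2) (L 4)) + 1 \<odot> Z (L 1) (X (Z (L 2) (L 4)) (L 3))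
      + 1 \<odot> Z (L 1) (Z (L 2) (X (L 3) (L 4))) + 2 \<odot> X (L 1) (Z (Z (L 2) (L 4)) (L 3)))"

definition bracket_bracket_prod_1324 :: "tree \<Rightarrow>\<^sub>0 'k::field_char_0" where
  "bracket_bracket_prod_1324 = rule_elem (Z (Z (L 1) (L 3)) (X (L 2) (L 4)),
     1 \<odot> Z (Z (L 1) (X (L 3) (L 4))) (L 2) - 2 \<odot> X (Z (L 1) (L 3)) (Z (L 2) (L 4)) + 2 \<odot> X (Z (L 1) (Z (L 3) (L 4))) (L 2)
      + 1 \<odot> Z (L 1) (X (Z (L 2) (L 4)) (L 3)) + 1 \<odot> Z (L 1) (Z (L 2) (X (L 3) (L 4))) - 1 \<odot> Z (L 1) (X (L 2) (Z (L 3) (L 4)))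
      + 2 \<odot> X (L 1) (Z (Z (L 2) (L 4)) (L 3)))"

lemmas arity4_defs = prod_bracket_bracket_1423_def prod_bracket_prod_1324_def prod_bracket_prod_1423_def prod_bracket_prod_1342_def bracket_bracket_prod_1423_def bracket_bracket_prod_1324_def rule_elem_def

text \<open>Each of the following six identities expresses a rule of arity 4, or twice the rule, through the 120
  compositions of rules of arity 3 with one operation and the rules of arity 4 already treated. The
  coefficients are a sparse solution of the corresponding linear system.\<close>

lemma prod_bracket_bracket_1423_ideal: "prod_bracket_bracket_1423 \<in> ideal comGD_relations 4"
proof -
  have "scale 2 prod_bracket_bracket_1423 =
      under_right Prod jacobi_123
      + plug prod_bracket_123 (Z (L 1) (L 2)) (L 3) (L 4)
      + plug prod_bracket_123 (Z (L 1) (L 4)) (L 2) (L 3)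
      + plug prod_bracket_123 (L 1) (Z (L 2) (L 4)) (L 3)
      + under_left Prod jacobi_123 1 2 4 3
      - plug prod_bracket_123 (L 1) (L 2) (Z (L 3) (L 4))
      - plug prod_bracket_123 (Z (L 1) (L 3)) (L 2) (L 4)
      - under_left Prod jacobi_123 1 2 3 4
      - plug prod_bracket_123 (L 1) (Z (L 2) (L 3)) (L 4)
      - under_left Prod jacobi_123 1 3 4 2"
    by (rule poly_mapping_eqI) (simp add: arity3_defs arity4_defs compose_coefficients)
  also have "\<dots> \<in> ideal comGD_relations 4"
    by (intro ideal_add ideal_diff ideal_scale plug_ideal under_left_ideal under_right_ideal
        arity3_ideal) (simp_all add: insert_commute)
  finally show ?thesis by (rule ideal_unscale) simp
qed

lemma prod_bracket_prod_1324_ideal: "prod_bracket_prod_1324 \<in> ideal comGD_relations 4"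
proof -
  have "scale 2 prod_bracket_prod_1324 =
      scale 4 (plug assoc_132 (Z (L 1) (L 4)) (L 2) (L 3))
      + scale 2 (under_right Prod bracket_prod_132)
      + scale 2 (plug assoc_132 (L 1) (Z (L 2) (L 4)) (L 3))
      + scale 2 (under_right Bracket assoc_123)
      + scale 2 (plug bracket_prod_123 (X (L 1) (L 3)) (L 2) (L 4))
      + scale 2 (under_left Prod bracket_prod_123 1 3 4 2)
      + plug bracket_prod_132 (L 1) (L 2) (X (L 3) (L 4))
      + under_right Bracket assoc_132
      + under_left Bracket assoc_123 1 3 4 2
      - plug bracket_prod_132 (L 1) (X (L 2) (L 4)) (L 3)
      - plug bracket_prod_132 (X (L 1) (L 3)) (L 2) (L 4)
      - scale 2 (plug bracket_prod_123 (L 1) (X (L 2) (L 3)) (L 4))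
      - scale 2 (under_left Bracket assoc_132 1 2 3 4)"
    by (rule poly_mapping_eqI) (simp add: arity3_defs arity4_defs compose_coefficients)
  also have "\<dots> \<in> ideal comGD_relations 4"
    by (intro ideal_add ideal_diff ideal_scale plug_ideal under_left_ideal under_right_ideal
        arity3_ideal) (simp_all add: insert_commute)
  finally show ?thesis by (rule ideal_unscale) simp
qed

lemma prod_bracket_prod_1423_ideal: "prod_bracket_prod_1423 \<in> ideal comGD_relations 4"
proof -
  have "prod_bracket_prod_1423 =
      prod_bracket_prod_1324
      + plug assoc_132 (L 1) (L 2) (Z (L 3) (L 4))
      + plug assoc_132 (Z (L 1) (L 3)) (L 2) (L 4)
      - plug assoc_132 (Z (L 1) (L 4)) (L 2) (L 3)
      - under_left Prod prod_bracket_123 1 3 4 2"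
    by (rule poly_mapping_eqI) (simp add: arity3_defs arity4_defs compose_coefficients)
  also have "\<dots> \<in> ideal comGD_relations 4"
    by (intro ideal_add ideal_diff ideal_scale plug_ideal under_left_ideal under_right_ideal
        arity3_ideal prod_bracket_prod_1324_ideal) (simp_all add: insert_commute)
  finally show ?thesis .
qed

lemma prod_bracket_prod_1342_ideal: "prod_bracket_prod_1342 \<in> ideal comGD_relations 4"
proof -
  have "prod_bracket_prod_1342 =
      under_left Prod prod_bracket_123 1 2 4 3
      + prod_bracket_prod_1423
      + plug assoc_123 (Z (L 1) (L 4)) (L 2) (L 3)
      - plug assoc_132 (Z (L 1) (L 2)) (L 3) (L 4)
      - plug prod_bracket_123 (L 1) (L 2) (X (L 3) (L 4))
      - plug assoc_123 (L 1) (Z (L 2) (L 4)) (L 3)"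
    by (rule poly_mapping_eqI) (simp add: arity3_defs arity4_defs compose_coefficients)
  also have "\<dots> \<in> ideal comGD_relations 4"
    by (intro ideal_add ideal_diff ideal_scale plug_ideal under_left_ideal under_right_ideal
        arity3_ideal prod_bracket_prod_1423_ideal) (simp_all add: insert_commute)
  finally show ?thesis .
qed

lemma bracket_bracket_prod_1423_ideal: "bracket_bracket_prod_1423 \<in> ideal comGD_relations 4"
proof -
  have "bracket_bracket_prod_1423 =
      scale 2 (prod_bracket_bracket_1423)
      + scale 2 (plug prod_bracket_123 (L 1) (L 2) (Z (L 3) (L 4)))
      + plug jacobi_123 (L 1) (L 2) (X (L 3) (L 4))
      + plug bracket_prod_123 (Z (L 1) (L 4)) (L 2) (L 3)
      + under_left Bracket prod_bracket_123 1 2 4 3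
      - plug bracket_prod_132 (Z (L 1) (L 2)) (L 3) (L 4)
      - plug bracket_prod_123 (L 1) (Z (L 2) (L 4)) (L 3)
      - scale 2 (plug prod_bracket_123 (L 1) (Z (L 2) (L 4)) (L 3))
      - scale 2 (under_left Prod jacobi_123 1 2 4 3)
      - scale 2 (plug prod_bracket_123 (Z (L 1) (L 4)) (L 2) (L 3))"
    by (rule poly_mapping_eqI) (simp add: arity3_defs arity4_defs compose_coefficients)
  also have "\<dots> \<in> ideal comGD_relations 4"
    by (intro ideal_add ideal_diff ideal_scale plug_ideal under_left_ideal under_right_ideal
        arity3_ideal prod_bracket_bracket_1423_ideal) (simp_all add: insert_commute)
  finally show ?thesis .
qed

lemma bracket_bracket_prod_1324_ideal: "bracket_bracket_prod_1324 \<in> ideal comGD_relations 4"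
proof -
  have "bracket_bracket_prod_1324 =
      scale 2 (prod_bracket_bracket_1423)
      + scale 2 (under_left Prod jacobi_123 1 3 4 2)
      + bracket_bracket_prod_1423
      + plug bracket_prod_132 (Z (L 1) (L 3)) (L 2) (L 4)
      + plug bracket_prod_132 (L 1) (L 2) (Z (L 3) (L 4))
      - plug bracket_prod_132 (Z (L 1) (L 4)) (L 2) (L 3)
      - under_left Bracket prod_bracket_123 1 3 4 2"
    by (rule poly_mapping_eqI) (simp add: arity3_defs arity4_defs compose_coefficients)
  also have "\<dots> \<in> ideal comGD_relations 4"
    by (intro ideal_add ideal_diff ideal_scale plug_ideal under_left_ideal under_right_ideal
        arity3_ideal bracket_bracket_prod_1423_ideal prod_bracket_bracket_1423_ideal) (simp_all add: insert_commute)
  finally show ?thesis .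
qed

lemma rules_in_ideal:
  "f \<in> rule_elem ` comGD_rules \<Longrightarrow> \<exists>n. f \<in> ideal comGD_relations n"
  using arity3_ideal prod_bracket_bracket_1423_ideal prod_bracket_prod_1324_ideal
    prod_bracket_prod_1423_ideal prod_bracket_prod_1342_ideal
    bracket_bracket_prod_1423_ideal bracket_bracket_prod_1324_ideal
  unfolding comGD_rules_def arity3_defs(1-6) arity4_defs(1-6) by (auto simp only: image_insert image_empty)

section \<open>The path order orients the rules\<close>

text \<open>The left-hand side cannot be cancelled by the right-hand side, as it is not below itself.\<close>

lemma is_leading_rule:
  assumes "monomial_order lt" "u \<in> monomials n" and below: "\<forall>s\<in>Poly_Mapping.keys v. lt s u"
  shows "is_leading lt (rule_elem (u, v)) u"
proof -
  have "u \<notin> Poly_Mapping.keys v" using below lt_irrefl[OF assms(1,2)] by blast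
  then have "u \<in> Poly_Mapping.keys (rule_elem (u, v))"
    by (simp add: rule_elem_def in_keys_iff lookup_minus)
  moreover have "Poly_Mapping.keys (rule_elem (u, v)) \<subseteq> insert u (Poly_Mapping.keys v)"
    using keys_diff[of "1 \<odot> u" v] by (auto simp: rule_elem_def)
  ultimately show ?thesis using below unfolding is_leading_def by blast
qed

lemma keys_below:
  "P t \<Longrightarrow> \<forall>s\<in>Poly_Mapping.keys (c \<odot> t). P s"
  "\<forall>s\<in>Poly_Mapping.keys v. P s \<Longrightarrow> \<forall>s\<in>Poly_Mapping.keys w. P s \<Longrightarrow> \<forall>s\<in>Poly_Mapping.keys (v + w). P s"
  "\<forall>s\<in>Poly_Mapping.keys v. P s \<Longrightarrow> \<forall>s\<in>Poly_Mapping.keys w. P s \<Longrightarrow> \<forall>s\<in>Poly_Mapping.keys (v - w). P s"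
  using Poly_Mapping.keys_add[of v w] keys_diff[of v w] by auto

lemma path_less_orients: "rules_oriented path_less comGD_rules"
proof -
  have sets: "{1..3} = {1, 2, 3::nat}" "{1..4} = {1, 2, 3, 4::nat}" by auto
  have "\<exists>n. u \<in> monomials n" "\<forall>s\<in>Poly_Mapping.keys v. path_less s u"
    if "(u, v) \<in> comGD_rules" for u and v :: "tree \<Rightarrow>\<^sub>0 'k::field_char_0"
  proof -
    have "u \<in> monomials 3 \<or> u \<in> monomials 4"
      using that unfolding comGD_rules_def monomials_def sets by auto
    then show "\<exists>n. u \<in> monomials n" by blast
    show "\<forall>s\<in>Poly_Mapping.keys v. path_less s u"
      using that unfolding comGD_rules_def
      by (elim insertE emptyE Pair_inject; hypsubst; intro keys_below;
          simp add: path_less_def word_less_def Cons_lenlex_iff)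
  qed
  then show ?thesis
    unfolding rules_oriented_def using is_leading_rule[OF monomial_order_path_less] by blast
qed

section \<open>The Groebner basis\<close>

lemma left_sides_shuffle: "s \<in> set left_sides \<Longrightarrow> shuffle_tree s"
  by (auto simp: left_sides_def)

lemma irreducible_independent:
  fixes f :: "tree \<Rightarrow>\<^sub>0 'k::field_char_0"
  assumes n: "n \<le> 4" and f: "f \<in> ideal comGD_relations n"
    and irr: "\<forall>t\<in>Poly_Mapping.keys f. \<not> (\<exists>s\<in>set left_sides. divides s t)"
  shows "f = 0"
proof -
  have keys: "Poly_Mapping.keys f \<subseteq> set (normal_trees n)"
  proof
    fix t assume t: "t \<in> Poly_Mapping.keys f"
    then have mon: "t \<in> monomials n" using f ideal_free unfolding free_operad_def by blast
    show "t \<in> set (normal_trees n)"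
      unfolding normal_trees_def
    proof (rule monomials_avoiding[OF mon])
      fix u assume "u \<in> subtrees t"
      then show "\<not> (\<exists>s\<in>set left_sides. redex s u)"
        using irr t mon redex_divides left_sides_shuffle unfolding monomials_def by blast
    qed
  qed
  consider "n = 0" | "n = 1" | "n = 2" | "n = 3" | "n = 4" using n by linarith
  then show ?thesis
  proof cases
    case 1
    then show ?thesis using keys by (simp add: normal_trees_0)
  next
    case 2
    have "Poly_Mapping.lookup f (L 1) = 0"
      using ideal_equation[OF f, of "[L 1]"] keys 2 by (simp add: normal_trees_1)
    then show ?thesis using keys 2 by (intro poly_mapping_zero_on[OF keys]) (simp add: normal_trees_1)
  qed (use f keys normal_independent_2 normal_independent_3 normal_independent_4 in blast)+
qed

theorem theorem2p2:
  "(\<exists>lt. monomial_order lt \<and>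
      rules_oriented lt (comGD_rules :: (tree \<times> (tree \<Rightarrow>\<^sub>0 'k::field_char_0)) set)) \<and>
   (\<forall>lt. monomial_order lt \<longrightarrow>
      rules_oriented lt (comGD_rules :: (tree \<times> (tree \<Rightarrow>\<^sub>0 'k)) set) \<longrightarrow>
      groebner_basis_upto 4 lt (ideal (comGD_relations :: (tree \<Rightarrow>\<^sub>0 'k) set))
        (rule_elem ` comGD_rules))"
proof (intro conjI allI impI)
  show "\<exists>lt. monomial_order lt \<and>
      rules_oriented lt (comGD_rules :: (tree \<times> (tree \<Rightarrow>\<^sub>0 'k::field_char_0)) set)"
    using monomial_order_path_less path_less_orients by blast
next
  fix lt
  assume mo: "monomial_order lt"
    and or: "rules_oriented lt (comGD_rules :: (tree \<times> (tree \<Rightarrow>\<^sub>0 'k)) set)"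
  let ?I = "ideal (comGD_relations :: (tree \<Rightarrow>\<^sub>0 'k) set)"
  let ?G = "rule_elem ` (comGD_rules :: (tree \<times> (tree \<Rightarrow>\<^sub>0 'k)) set)"
  have lead: "\<exists>g\<in>?G. is_leading lt g s" if "s \<in> set left_sides" for s
    using that or unfolding left_sides[symmetric, where 'a = 'k] rules_oriented_def by fastforce
  have div: "\<exists>s\<in>set left_sides. divides s t"
    if n: "n \<le> 4" and f: "f \<in> ?I n" and t: "is_leading lt f t" for n f t
  proof (rule leading_reducible[OF mo finite_monomials _ irreducible_independent[OF n] f t])
    fix t assume "t \<in> monomials n" "\<exists>s\<in>set left_sides. divides s t"
    then show "\<exists>h\<in>?I n. is_leading lt h t"
      using lead rules_in_ideal leading_of_divisible[OF mo] by metis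
  qed
  show "groebner_basis_upto 4 lt ?I ?G"
    unfolding groebner_basis_upto_def
  proof (intro conjI allI impI ballI)
    show "?G \<subseteq> (\<Union>n. ?I n)" using rules_in_ideal by blast
    fix n f assume n: "n \<le> 4" and f: "f \<in> ?I n" "f \<noteq> 0"
    obtain t where "is_leading lt f t"
      using leading_exists[OF mo _ f(2)] f(1) ideal_free by blast
    then show "\<exists>t. is_leading lt f t \<and> (\<exists>g\<in>?G. \<exists>s. is_leading lt g s \<and> divides s t)"
      using div[OF n f(1)] lead by blast
  qed
qed

end
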